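(* Let $\mathcal A$ be a category, $S\subseteq\mathsf{Mor}(\mathcal A)$ a class of morphisms, and $I$ a (small) set. Let $Q:\mathcal A\to\mathcal A[S^{-1}]$ and $Q_I:\mathcal A^I\to(\mathcal A^I)[(S^I)^{-1}]$ be the localizations. (a) If $S$ admits a right calculus of fractions in $\mathcal A$ (respectively, a left calculus of fractions), then $S^I$ admits a right calculus of fractions in $\mathcal A^I$ (respectively, a left calculus of fractions), and the canonical functor obtained by factoring $Q^I:\mathcal A^I\to(\mathcal A[S^{-1}])^I$ through $Q_I$, $$\Theta_I:(\mathcal A^I)[(S^I)^{-1}]\longrightarrow(\mathcal A[S^{-1}])^I,\qquad\Theta_I\circ Q_I=Q^I,$$ is an isomorphism of categories. (b) Assume that $S$ admits a left or right calculus of fractions. If $\mathcal A$ has $I$-indexed coproducts (respectively, $I$-indexed products) and $S$ is closed under $I$-indexed coproducts (respectively, products), then $\mathcal A[S^{-1}]$ has $I$-indexed coproducts (respectively, products) and $Q$ preserves them.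
   Context: Size issues are ignored (or handled by universes); localizations always exist. The Gabriel--Zisman localization $Q:\mathcal A\to\mathcal A[S^{-1}]$ is the functor sending every morphism of $S$ to an isomorphism such that every functor out of $\mathcal A$ sending $S$ to isomorphisms factors uniquely (on the nose) through $Q$; it is taken in its standard construction, with $\mathsf{Ob}(\mathcal A[S^{-1}])=\mathsf{Ob}(\mathcal A)$. $\mathcal A^I$ is the product category $\prod_{i\in I}\mathcal A$, $S^I$ is the class of morphisms $(s_i)_{i\in I}$ of $\mathcal A^I$ with all $s_i\in S$, and $Q^I=\prod_{i\in I}Q$. $S$ admits a right calculus of fractions if it contains all identity morphisms, is closed under composition, and: (1) for all $f:X\to Y$ and $s:Y'\to Y$ with $s\in S$ there exist $t:X'\to X$ in $S$ and $f':X'\to Y'$ with $s\circ f'=f\circ t$; (2) for all $f,g:X\to Y$, if there is $s\in S$ with $s\circ f=s\circ g$, then there is $t\in S$ with $f\circ t=g\circ t$. A left calculus of fractions is defined by dualizing these conditions. $S$ is closed under $I$-indexed coproducts (resp. products) if for every family $(s_i:X_i\to Y_i)_{i\in I}$ of morphisms in $S$, the induced morphism $\coprod_{i}s_i:\coprod_i X_i\to\coprod_i Y_i$ (resp. $\prod_i s_i:\prod_i X_i\to\prod_i Y_i$) is in $S$. *)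

theory Defs
  imports Main "HOL-Library.FuncSet"
begin

section \<open>Categories and functors\<close>

record ('o, 'm) cat =
  Ob :: "'o set"
  Mor :: "'m set"
  Dom :: "'m \<Rightarrow> 'o"
  Cod :: "'m \<Rightarrow> 'o"
  Id :: "'o \<Rightarrow> 'm"
  Comp :: "'m \<Rightarrow> 'm \<Rightarrow> 'm"  (infixl "\<cdot>\<index>" 70)

definition Hom :: "('o, 'm) cat \<Rightarrow> 'o \<Rightarrow> 'o \<Rightarrow> 'm set" where
  "Hom A X Y = {f \<in> Mor A. Dom A f = X \<and> Cod A f = Y}"

locale category =
  fixes A :: "('o, 'm) cat" (structure)
  assumes Dom_Ob: "f \<in> Mor A \<Longrightarrow> Dom A f \<in> Ob A"
    and Cod_Ob: "f \<in> Mor A \<Longrightarrow> Cod A f \<in> Ob A"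
    and Id_Hom: "X \<in> Ob A \<Longrightarrow> Id A X \<in> Hom A X X"
    and Comp_Hom: "f \<in> Hom A X Y \<Longrightarrow> g \<in> Hom A Y Z \<Longrightarrow> g \<cdot> f \<in> Hom A X Z"
    and Comp_Id: "f \<in> Hom A X Y \<Longrightarrow> f \<cdot> Id A X = f"
    and Id_Comp: "f \<in> Hom A X Y \<Longrightarrow> Id A Y \<cdot> f = f"
    and Comp_assoc: "f \<in> Hom A W X \<Longrightarrow> g \<in> Hom A X Y \<Longrightarrow> h \<in> Hom A Y Z \<Longrightarrow>
      h \<cdot> (g \<cdot> f) = (h \<cdot> g) \<cdot> f"

definition is_iso :: "('o, 'm) cat \<Rightarrow> 'm \<Rightarrow> bool" where
  "is_iso A f \<longleftrightarrow> f \<in> Mor A \<and>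
    (\<exists>g \<in> Hom A (Cod A f) (Dom A f). g \<cdot>\<^bsub>A\<^esub> f = Id A (Dom A f) \<and> f \<cdot>\<^bsub>A\<^esub> g = Id A (Cod A f))"

record ('o, 'm, 'p, 'n) fctr =
  FOb :: "'o \<Rightarrow> 'p"
  FMor :: "'m \<Rightarrow> 'n"

text \<open>The maps underlying a functor are required to be extensional (undefined outside of the
  source category), so that HOL equality of functors is equality on objects and morphisms.\<close>

definition is_functor :: "('o, 'm) cat \<Rightarrow> ('p, 'n) cat \<Rightarrow> ('o, 'm, 'p, 'n) fctr \<Rightarrow> bool" where
  "is_functor A B F \<longleftrightarrow> category A \<and> category B \<and>
    FOb F \<in> Ob A \<rightarrow>\<^sub>E Ob B \<and> FMor F \<in> Mor A \<rightarrow>\<^sub>E Mor B \<and>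
    (\<forall>f \<in> Mor A. Dom B (FMor F f) = FOb F (Dom A f) \<and> Cod B (FMor F f) = FOb F (Cod A f)) \<and>
    (\<forall>X \<in> Ob A. FMor F (Id A X) = Id B (FOb F X)) \<and>
    (\<forall>f \<in> Mor A. \<forall>g \<in> Mor A. Cod A f = Dom A g \<longrightarrow>
      FMor F (g \<cdot>\<^bsub>A\<^esub> f) = FMor F g \<cdot>\<^bsub>B\<^esub> FMor F f)"

definition id_fctr :: "('o, 'm) cat \<Rightarrow> ('o, 'm, 'o, 'm) fctr" where
  "id_fctr A = \<lparr>FOb = (\<lambda>X \<in> Ob A. X), FMor = (\<lambda>f \<in> Mor A. f)\<rparr>"

definition comp_fctr :: "('o, 'm) cat \<Rightarrow> ('p, 'n, 'q, 'k) fctr \<Rightarrow> ('o, 'm, 'p, 'n) fctr \<Rightarrow>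
    ('o, 'm, 'q, 'k) fctr" where
  "comp_fctr A G F = \<lparr>FOb = compose (Ob A) (FOb G) (FOb F), FMor = compose (Mor A) (FMor G) (FMor F)\<rparr>"

definition is_cat_iso :: "('o, 'm) cat \<Rightarrow> ('p, 'n) cat \<Rightarrow> ('o, 'm, 'p, 'n) fctr \<Rightarrow> bool" where
  "is_cat_iso A B F \<longleftrightarrow> is_functor A B F \<and>
    (\<exists>G. is_functor B A G \<and> comp_fctr A G F = id_fctr A \<and> comp_fctr B F G = id_fctr B)"


section \<open>Powers of a category\<close>

definition power_cat :: "'i set \<Rightarrow> ('o, 'm) cat \<Rightarrow> ('i \<Rightarrow> 'o, 'i \<Rightarrow> 'm) cat" where
  "power_cat I A = \<lparr>Ob = I \<rightarrow>\<^sub>E Ob A, Mor = I \<rightarrow>\<^sub>E Mor A,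
    Dom = (\<lambda>f. \<lambda>i \<in> I. Dom A (f i)), Cod = (\<lambda>f. \<lambda>i \<in> I. Cod A (f i)),
    Id = (\<lambda>X. \<lambda>i \<in> I. Id A (X i)), Comp = (\<lambda>g f. \<lambda>i \<in> I. g i \<cdot>\<^bsub>A\<^esub> f i)\<rparr>"

definition power_mors :: "'i set \<Rightarrow> 'm set \<Rightarrow> ('i \<Rightarrow> 'm) set" where
  "power_mors I S = (I \<rightarrow>\<^sub>E S)"

definition power_fctr :: "'i set \<Rightarrow> ('o, 'm) cat \<Rightarrow> ('o, 'm, 'p, 'n) fctr \<Rightarrow>
    ('i \<Rightarrow> 'o, 'i \<Rightarrow> 'm, 'i \<Rightarrow> 'p, 'i \<Rightarrow> 'n) fctr" where
  "power_fctr I A F = \<lparr>FOb = (\<lambda>X \<in> I \<rightarrow>\<^sub>E Ob A. \<lambda>i \<in> I. FOb F (X i)),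
    FMor = (\<lambda>f \<in> I \<rightarrow>\<^sub>E Mor A. \<lambda>i \<in> I. FMor F (f i))\<rparr>"


section \<open>Calculi of fractions\<close>

definition right_calculus :: "('o, 'm) cat \<Rightarrow> 'm set \<Rightarrow> bool" where
  "right_calculus A S \<longleftrightarrow>
    (\<forall>X \<in> Ob A. Id A X \<in> S) \<and>
    (\<forall>s \<in> S. \<forall>t \<in> S. Cod A s = Dom A t \<longrightarrow> t \<cdot>\<^bsub>A\<^esub> s \<in> S) \<and>
    (\<forall>X Y Y' f s. f \<in> Hom A X Y \<and> s \<in> S \<inter> Hom A Y' Y \<longrightarrow>
      (\<exists>X' t f'. t \<in> S \<inter> Hom A X' X \<and> f' \<in> Hom A X' Y' \<and> s \<cdot>\<^bsub>A\<^esub> f' = f \<cdot>\<^bsub>A\<^esub> t)) \<and>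
    (\<forall>X Y f g. f \<in> Hom A X Y \<and> g \<in> Hom A X Y \<and>
        (\<exists>Y'. \<exists>s \<in> S \<inter> Hom A Y Y'. s \<cdot>\<^bsub>A\<^esub> f = s \<cdot>\<^bsub>A\<^esub> g) \<longrightarrow>
      (\<exists>X'. \<exists>t \<in> S \<inter> Hom A X' X. f \<cdot>\<^bsub>A\<^esub> t = g \<cdot>\<^bsub>A\<^esub> t))"

definition left_calculus :: "('o, 'm) cat \<Rightarrow> 'm set \<Rightarrow> bool" where
  "left_calculus A S \<longleftrightarrow>
    (\<forall>X \<in> Ob A. Id A X \<in> S) \<and>
    (\<forall>s \<in> S. \<forall>t \<in> S. Cod A s = Dom A t \<longrightarrow> t \<cdot>\<^bsub>A\<^esub> s \<in> S) \<and>
    (\<forall>X Y Y' f s. f \<in> Hom A Y X \<and> s \<in> S \<inter> Hom A Y Y' \<longrightarrow>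
      (\<exists>X' t f'. t \<in> S \<inter> Hom A X X' \<and> f' \<in> Hom A Y' X' \<and> f' \<cdot>\<^bsub>A\<^esub> s = t \<cdot>\<^bsub>A\<^esub> f)) \<and>
    (\<forall>X Y f g. f \<in> Hom A Y X \<and> g \<in> Hom A Y X \<and>
        (\<exists>Y'. \<exists>s \<in> S \<inter> Hom A Y' Y. f \<cdot>\<^bsub>A\<^esub> s = g \<cdot>\<^bsub>A\<^esub> s) \<longrightarrow>
      (\<exists>X'. \<exists>t \<in> S \<inter> Hom A X X'. t \<cdot>\<^bsub>A\<^esub> f = t \<cdot>\<^bsub>A\<^esub> g))"


section \<open>Coproducts and products\<close>

definition is_coproduct :: "'i set \<Rightarrow> ('o, 'm) cat \<Rightarrow> ('i \<Rightarrow> 'o) \<Rightarrow> 'o \<Rightarrow> ('i \<Rightarrow> 'm) \<Rightarrow> bool" where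
  "is_coproduct I A X C j \<longleftrightarrow>
    X \<in> I \<rightarrow> Ob A \<and> C \<in> Ob A \<and> (\<forall>i \<in> I. j i \<in> Hom A (X i) C) \<and>
    (\<forall>D f. D \<in> Ob A \<and> (\<forall>i \<in> I. f i \<in> Hom A (X i) D) \<longrightarrow>
      (\<exists>!u. u \<in> Hom A C D \<and> (\<forall>i \<in> I. u \<cdot>\<^bsub>A\<^esub> j i = f i)))"

definition is_product :: "'i set \<Rightarrow> ('o, 'm) cat \<Rightarrow> ('i \<Rightarrow> 'o) \<Rightarrow> 'o \<Rightarrow> ('i \<Rightarrow> 'm) \<Rightarrow> bool" where
  "is_product I A X P p \<longleftrightarrow>
    X \<in> I \<rightarrow> Ob A \<and> P \<in> Ob A \<and> (\<forall>i \<in> I. p i \<in> Hom A P (X i)) \<and>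
    (\<forall>D f. D \<in> Ob A \<and> (\<forall>i \<in> I. f i \<in> Hom A D (X i)) \<longrightarrow>
      (\<exists>!u. u \<in> Hom A D P \<and> (\<forall>i \<in> I. p i \<cdot>\<^bsub>A\<^esub> u = f i)))"

definition has_coproducts :: "'i set \<Rightarrow> ('o, 'm) cat \<Rightarrow> bool" where
  "has_coproducts I A \<longleftrightarrow> (\<forall>X \<in> I \<rightarrow>\<^sub>E Ob A. \<exists>C j. is_coproduct I A X C j)"

definition has_products :: "'i set \<Rightarrow> ('o, 'm) cat \<Rightarrow> bool" where
  "has_products I A \<longleftrightarrow> (\<forall>X \<in> I \<rightarrow>\<^sub>E Ob A. \<exists>P p. is_product I A X P p)"

definition preserves_coproducts ::
    "'i set \<Rightarrow> ('o, 'm) cat \<Rightarrow> ('p, 'n) cat \<Rightarrow> ('o, 'm, 'p, 'n) fctr \<Rightarrow> bool" where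
  "preserves_coproducts I A B F \<longleftrightarrow> (\<forall>X C j. is_coproduct I A X C j \<longrightarrow>
    is_coproduct I B (\<lambda>i. FOb F (X i)) (FOb F C) (\<lambda>i. FMor F (j i)))"

definition preserves_products ::
    "'i set \<Rightarrow> ('o, 'm) cat \<Rightarrow> ('p, 'n) cat \<Rightarrow> ('o, 'm, 'p, 'n) fctr \<Rightarrow> bool" where
  "preserves_products I A B F \<longleftrightarrow> (\<forall>X P p. is_product I A X P p \<longrightarrow>
    is_product I B (\<lambda>i. FOb F (X i)) (FOb F P) (\<lambda>i. FMor F (p i)))"

text \<open>The morphism induced by a family \<open>s i : X i \<rightarrow> Y i\<close> depends on which coproducts of \<open>X\<close> and \<open>Y\<close>
  are meant, and \<open>S\<close> need not be stable under isomorphism.  Closure is therefore stated relative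
  to a choice \<open>C, j\<close> of coproducts of all families; some such choice is required to work.  If \<open>A\<close>
  has coproducts, this is implied by closure with respect to all choices.\<close>

definition closed_under_coproducts :: "'i set \<Rightarrow> ('o, 'm) cat \<Rightarrow> 'm set \<Rightarrow> bool" where
  "closed_under_coproducts I A S \<longleftrightarrow> (\<exists>C j.
    (\<forall>X \<in> I \<rightarrow>\<^sub>E Ob A. is_coproduct I A X (C X) (j X)) \<and>
    (\<forall>X \<in> I \<rightarrow>\<^sub>E Ob A. \<forall>Y \<in> I \<rightarrow>\<^sub>E Ob A. \<forall>s u.
      (\<forall>i \<in> I. s i \<in> S \<inter> Hom A (X i) (Y i)) \<and>
      u \<in> Hom A (C X) (C Y) \<and> (\<forall>i \<in> I. u \<cdot>\<^bsub>A\<^esub> j X i = j Y i \<cdot>\<^bsub>A\<^esub> s i) \<longrightarrow> u \<in> S))"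

definition closed_under_products :: "'i set \<Rightarrow> ('o, 'm) cat \<Rightarrow> 'm set \<Rightarrow> bool" where
  "closed_under_products I A S \<longleftrightarrow> (\<exists>P p.
    (\<forall>X \<in> I \<rightarrow>\<^sub>E Ob A. is_product I A X (P X) (p X)) \<and>
    (\<forall>X \<in> I \<rightarrow>\<^sub>E Ob A. \<forall>Y \<in> I \<rightarrow>\<^sub>E Ob A. \<forall>s u.
      (\<forall>i \<in> I. s i \<in> S \<inter> Hom A (X i) (Y i)) \<and>
      u \<in> Hom A (P X) (P Y) \<and> (\<forall>i \<in> I. p Y i \<cdot>\<^bsub>A\<^esub> u = s i \<cdot>\<^bsub>A\<^esub> p X i) \<longrightarrow> u \<in> S))"


section \<open>The Gabriel-Zisman localization\<close>

text \<open>The standard construction: the objects of \<open>A[S\<^sup>-\<^sup>1]\<close> are those of \<open>A\<close>; its morphisms are the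
  paths in the graph with edges the morphisms of \<open>A\<close> (\<open>Fwd\<close>) and formal inverses of those in \<open>S\<close>
  (\<open>Bwd\<close>), modulo the congruence generated by the relations making \<open>Fwd\<close> functorial and \<open>Bwd s\<close>
  inverse to \<open>Fwd s\<close>.  Paths are listed in order of traversal, so composition reverses
  concatenation.\<close>

datatype 'm edge = Fwd 'm | Bwd 'm

fun path :: "('o, 'm) cat \<Rightarrow> 'm set \<Rightarrow> 'o \<Rightarrow> 'm edge list \<Rightarrow> 'o \<Rightarrow> bool" where
  "path A S X [] Y \<longleftrightarrow> X \<in> Ob A \<and> X = Y"
| "path A S X (Fwd f # p) Y \<longleftrightarrow> f \<in> Mor A \<and> Dom A f = X \<and> path A S (Cod A f) p Y"
| "path A S X (Bwd s # p) Y \<longleftrightarrow> s \<in> S \<and> Cod A s = X \<and> path A S (Dom A s) p Y"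

inductive path_eq :: "('o, 'm) cat \<Rightarrow> 'm set \<Rightarrow> 'o \<Rightarrow> 'o \<Rightarrow> 'm edge list \<Rightarrow> 'm edge list \<Rightarrow> bool"
  for A :: "('o, 'm) cat" and S :: "'m set" where
  refl: "path A S X p Y \<Longrightarrow> path_eq A S X Y p p"
| sym: "path_eq A S X Y p q \<Longrightarrow> path_eq A S X Y q p"
| trans: "path_eq A S X Y p q \<Longrightarrow> path_eq A S X Y q r \<Longrightarrow> path_eq A S X Y p r"
| cong: "path_eq A S X Y p q \<Longrightarrow> path_eq A S Y Z p' q' \<Longrightarrow> path_eq A S X Z (p @ p') (q @ q')"
| Fwd_Id: "X \<in> Ob A \<Longrightarrow> path_eq A S X X [Fwd (Id A X)] []"
| Fwd_Comp: "f \<in> Hom A X Y \<Longrightarrow> g \<in> Hom A Y Z \<Longrightarrow>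
    path_eq A S X Z [Fwd f, Fwd g] [Fwd (g \<cdot>\<^bsub>A\<^esub> f)]"
| Fwd_Bwd: "s \<in> S \<Longrightarrow> s \<in> Hom A X Y \<Longrightarrow> path_eq A S X X [Fwd s, Bwd s] []"
| Bwd_Fwd: "s \<in> S \<Longrightarrow> s \<in> Hom A X Y \<Longrightarrow> path_eq A S Y Y [Bwd s, Fwd s] []"

text \<open>A morphism of the localization is recorded as source, target and class of paths.\<close>

type_synonym ('o, 'm) loc_mor = "'o \<times> 'o \<times> 'm edge list set"

definition path_class :: "('o, 'm) cat \<Rightarrow> 'm set \<Rightarrow> 'o \<Rightarrow> 'o \<Rightarrow> 'm edge list \<Rightarrow> ('o, 'm) loc_mor" where
  "path_class A S X Y p = (X, Y, {q. path_eq A S X Y p q})"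

definition loc :: "('o, 'm) cat \<Rightarrow> 'm set \<Rightarrow> ('o, ('o, 'm) loc_mor) cat" where
  "loc A S = \<lparr>Ob = Ob A,
    Mor = {path_class A S X Y p | X Y p. path A S X p Y},
    Dom = (\<lambda>(X, Y, P). X), Cod = (\<lambda>(X, Y, P). Y),
    Id = (\<lambda>X. path_class A S X X []),
    Comp = (\<lambda>(Y', Z, Q) (X, Y, P). (X, Z, {r. \<exists>p \<in> P. \<exists>q \<in> Q. path_eq A S X Z (p @ q) r}))\<rparr>"

definition loc_fctr :: "('o, 'm) cat \<Rightarrow> 'm set \<Rightarrow> ('o, 'm, 'o, ('o, 'm) loc_mor) fctr" where
  "loc_fctr A S = \<lparr>FOb = (\<lambda>X \<in> Ob A. X),
    FMor = (\<lambda>f \<in> Mor A. path_class A S (Dom A f) (Cod A f) [Fwd f])\<rparr>"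


text \<open>The canonical functor \<open>\<Theta>\<^sub>I\<close>, characterized by factoring \<open>Q\<^sup>I\<close> through \<open>Q\<^sub>I\<close>.\<close>

definition is_canonical_comparison :: "'i set \<Rightarrow> ('o, 'm) cat \<Rightarrow> 'm set \<Rightarrow>
    ('i \<Rightarrow> 'o, ('i \<Rightarrow> 'o, 'i \<Rightarrow> 'm) loc_mor, 'i \<Rightarrow> 'o, 'i \<Rightarrow> ('o, 'm) loc_mor) fctr \<Rightarrow> bool" where
  "is_canonical_comparison I A S \<Theta> \<longleftrightarrow>
    is_functor (loc (power_cat I A) (power_mors I S)) (power_cat I (loc A S)) \<Theta> \<and>
    comp_fctr (power_cat I A) \<Theta> (loc_fctr (power_cat I A) (power_mors I S)) =
      power_fctr I A (loc_fctr A S)"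

text \<open>The construction has the defining universal property of the localization
  (\<open>loc_universal\<close> below).\<close>

lemma path_Ob: "category A \<Longrightarrow> S \<subseteq> Mor A \<Longrightarrow> path A S X p Y \<Longrightarrow> X \<in> Ob A \<and> Y \<in> Ob A"
  by (induction A S X p Y rule: path.induct) (auto simp: category.Dom_Ob category.Cod_Ob)

lemma path_append:
  "category A \<Longrightarrow> S \<subseteq> Mor A \<Longrightarrow> path A S X p Y \<Longrightarrow> path A S Y q Z \<Longrightarrow> path A S X (p @ q) Z"
  by (induction A S X p Y rule: path.induct) auto

lemma path_eq_path:
  assumes "category A" "S \<subseteq> Mor A"
  shows "path_eq A S X Y p q \<Longrightarrow> path A S X p Y \<and> path A S X q Y"
proof (induction rule: path_eq.induct)
  case (cong X Y p q Z p' q')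
  then show ?case using path_append[OF assms] by blast
next
  case (Fwd_Id X)
  then show ?case using category.Id_Hom[OF assms(1)] by (auto simp: Hom_def)
next
  case (Fwd_Comp f X Y g Z)
  then show ?case using category.Comp_Hom[OF assms(1) Fwd_Comp]
    by (auto simp: Hom_def category.Cod_Ob[OF assms(1)])
qed (auto simp: Hom_def category.Cod_Ob[OF assms(1)] category.Dom_Ob[OF assms(1)])

lemma path_class_eqI: "path_eq A S X Y p q \<Longrightarrow> path_class A S X Y p = path_class A S X Y q"
  unfolding path_class_def by (blast intro: path_eq.sym path_eq.trans)

lemma loc_simps:
  "Ob (loc A S) = Ob A"
  "Dom (loc A S) (path_class A S X Y p) = X"
  "Cod (loc A S) (path_class A S X Y p) = Y"
  "Id (loc A S) X = path_class A S X X []"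
  by (auto simp: loc_def path_class_def)

lemma loc_Comp_class:
  assumes "path A S X p Y" "path A S Y q Z"
  shows "Comp (loc A S) (path_class A S Y Z q) (path_class A S X Y p) = path_class A S X Z (p @ q)"
proof -
  have "(\<exists>p'. path_eq A S X Y p p' \<and> (\<exists>q'. path_eq A S Y Z q q' \<and> path_eq A S X Z (p' @ q') r))
      \<longleftrightarrow> path_eq A S X Z (p @ q) r" for r
    using assms by (blast intro: path_eq.refl path_eq.trans path_eq.cong)
  then show ?thesis by (simp add: loc_def path_class_def)
qed

lemma loc_HomE:
  assumes "f \<in> Hom (loc A S) X Y"
  obtains p where "path A S X p Y" "f = path_class A S X Y p"
  using assms by (auto simp: Hom_def loc_def path_class_def)

lemma loc_HomI: "path A S X p Y \<Longrightarrow> path_class A S X Y p \<in> Hom (loc A S) X Y"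
  by (auto simp: Hom_def loc_def path_class_def)

lemma category_loc:
  assumes A: "category A" and S: "S \<subseteq> Mor A"
  shows "category (loc A S)"
proof
  show "Dom (loc A S) f \<in> Ob (loc A S)" "Cod (loc A S) f \<in> Ob (loc A S)" if "f \<in> Mor (loc A S)" for f
    using that path_Ob[OF A S] by (auto simp: loc_def path_class_def)
  show "Id (loc A S) X \<in> Hom (loc A S) X X" if "X \<in> Ob (loc A S)" for X
    using that loc_HomI[of A S X "[]" X] by (simp add: loc_simps)
  show "Comp (loc A S) g f \<in> Hom (loc A S) X Z"
    if f: "f \<in> Hom (loc A S) X Y" and g: "g \<in> Hom (loc A S) Y Z" for f g X Y Z
  proof -
    obtain p where p: "path A S X p Y" "f = path_class A S X Y p" using f by (rule loc_HomE)
    obtain q where q: "path A S Y q Z" "g = path_class A S Y Z q" using g by (rule loc_HomE)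
    show ?thesis using p q by (simp add: loc_Comp_class loc_HomI path_append[OF A S p(1) q(1)])
  qed
  show "Comp (loc A S) f (Id (loc A S) X) = f" "Comp (loc A S) (Id (loc A S) Y) f = f"
    if f: "f \<in> Hom (loc A S) X Y" for f X Y
  proof -
    obtain p where p: "path A S X p Y" "f = path_class A S X Y p" using f by (rule loc_HomE)
    have "path A S X [] X" "path A S Y [] Y" using path_Ob[OF A S p(1)] by auto
    with p show "Comp (loc A S) f (Id (loc A S) X) = f" "Comp (loc A S) (Id (loc A S) Y) f = f"
      using loc_Comp_class[of A S X "[]" X p Y] loc_Comp_class[of A S X p Y "[]" Y]
      by (auto simp: loc_simps)
  qed
  show "Comp (loc A S) h (Comp (loc A S) g f) = Comp (loc A S) (Comp (loc A S) h g) f"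
    if f: "f \<in> Hom (loc A S) W X" and g: "g \<in> Hom (loc A S) X Y" and h: "h \<in> Hom (loc A S) Y Z"
    for f g h W X Y Z
  proof -
    obtain p where p: "path A S W p X" "f = path_class A S W X p" using f by (rule loc_HomE)
    obtain q where q: "path A S X q Y" "g = path_class A S X Y q" using g by (rule loc_HomE)
    obtain r where r: "path A S Y r Z" "h = path_class A S Y Z r" using h by (rule loc_HomE)
    show ?thesis using p q r path_append[OF A S p(1) q(1)] path_append[OF A S q(1) r(1)]
      by (simp add: loc_Comp_class)
  qed
qed

lemma path_Fwd: "category A \<Longrightarrow> f \<in> Hom A X Y \<Longrightarrow> path A S X [Fwd f] Y"
  by (auto simp: Hom_def category.Cod_Ob)

lemma path_Bwd: "category A \<Longrightarrow> s \<in> S \<Longrightarrow> s \<in> Hom A X Y \<Longrightarrow> path A S Y [Bwd s] X"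
  by (auto simp: Hom_def category.Dom_Ob)

lemma loc_fctr_Hom:
  "f \<in> Hom A X Y \<Longrightarrow> FMor (loc_fctr A S) f = path_class A S X Y [Fwd f]"
  by (auto simp: Hom_def loc_fctr_def)

lemma is_functor_loc_fctr:
  assumes A: "category A" and S: "S \<subseteq> Mor A"
  shows "is_functor A (loc A S) (loc_fctr A S)"
proof -
  have mor: "FMor (loc_fctr A S) f \<in> Hom (loc A S) (Dom A f) (Cod A f)" if "f \<in> Mor A" for f
    using that loc_HomI[OF path_Fwd[OF A, of f "Dom A f" "Cod A f" S]]
    by (simp add: loc_fctr_def Hom_def)
  have id: "FMor (loc_fctr A S) (Id A X) = Id (loc A S) X" if X: "X \<in> Ob A" for X
    using category.Id_Hom[OF A X] path_class_eqI[OF path_eq.Fwd_Id[OF X, of S]]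
    by (simp add: loc_fctr_Hom loc_simps)
  have comp: "FMor (loc_fctr A S) (Comp A g f) = Comp (loc A S) (FMor (loc_fctr A S) g) (FMor (loc_fctr A S) f)"
    if f: "f \<in> Hom A X Y" and g: "g \<in> Hom A Y Z" for f g X Y Z
  proof -
    note gf = category.Comp_Hom[OF A f g]
    have "path_class A S X Z [Fwd (Comp A g f)] = path_class A S X Z [Fwd f, Fwd g]"
      by (rule path_class_eqI[OF path_eq.sym[OF path_eq.Fwd_Comp[OF f g]]])
    then show ?thesis
      using loc_Comp_class[OF path_Fwd[OF A f] path_Fwd[OF A g], of S]
      by (simp add: loc_fctr_Hom[OF f] loc_fctr_Hom[OF g] loc_fctr_Hom[OF gf])
  qed
  show ?thesis
    unfolding is_functor_def
  proof (intro conjI ballI impI)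
    show "category A" by fact
    show "category (loc A S)" by (rule category_loc[OF A S])
    show "FOb (loc_fctr A S) \<in> Ob A \<rightarrow>\<^sub>E Ob (loc A S)" by (auto simp: loc_fctr_def loc_simps)
    show "FMor (loc_fctr A S) \<in> Mor A \<rightarrow>\<^sub>E Mor (loc A S)"
    proof (rule PiE_I)
      show "FMor (loc_fctr A S) f \<in> Mor (loc A S)" if "f \<in> Mor A" for f
        using mor[OF that] by (simp add: Hom_def)
    qed (simp add: loc_fctr_def)
  qed (use mor id comp category.Dom_Ob[OF A] category.Cod_Ob[OF A] in
      \<open>auto simp: Hom_def loc_fctr_def loc_simps\<close>)
qed

lemma is_iso_loc_fctr:
  assumes A: "category A" and S: "S \<subseteq> Mor A" and s: "s \<in> S"
  shows "is_iso (loc A S) (FMor (loc_fctr A S) s)"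
proof -
  define X Y where "X = Dom A s" and "Y = Cod A s"
  have sH: "s \<in> Hom A X Y" using s S by (auto simp: Hom_def X_def Y_def)
  let ?f = "path_class A S X Y [Fwd s]" and ?g = "path_class A S Y X [Bwd s]"
  have pf: "path A S X [Fwd s] Y" by (rule path_Fwd[OF A sH])
  have pg: "path A S Y [Bwd s] X" by (rule path_Bwd[OF A s sH])
  have "Comp (loc A S) ?g ?f = Id (loc A S) X" "Comp (loc A S) ?f ?g = Id (loc A S) Y"
    using loc_Comp_class[OF pf pg] loc_Comp_class[OF pg pf]
      path_class_eqI[OF path_eq.Fwd_Bwd[OF s sH]] path_class_eqI[OF path_eq.Bwd_Fwd[OF s sH]]
    by (simp_all add: loc_simps)
  moreover have "?f \<in> Mor (loc A S)" using loc_HomI[OF pf] by (simp add: Hom_def)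
  ultimately show ?thesis
    using loc_HomI[OF pg] unfolding is_iso_def loc_fctr_Hom[OF sH] loc_simps by blast
qed

lemma is_functor_Hom: "is_functor A B F \<Longrightarrow> f \<in> Hom A X Y \<Longrightarrow> FMor F f \<in> Hom B (FOb F X) (FOb F Y)"
  unfolding is_functor_def Hom_def by auto

lemma is_functor_Comp:
  "is_functor A B F \<Longrightarrow> f \<in> Hom A X Y \<Longrightarrow> g \<in> Hom A Y Z \<Longrightarrow>
    FMor F (Comp A g f) = Comp B (FMor F g) (FMor F f)"
  unfolding is_functor_def Hom_def by auto

lemma inverse_unique:
  assumes B: "category B" and f: "f \<in> Hom B X Y" and g: "g \<in> Hom B Y X" and h: "h \<in> Hom B Y X"
    and gf: "Comp B g f = Id B X" and fh: "Comp B f h = Id B Y"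
  shows "g = h"
  using category.Comp_assoc[OF B h f g] category.Comp_Id[OF B g] category.Id_Comp[OF B h] gf fh by simp

theorem loc_universal:
  assumes A: "category A" and S: "S \<subseteq> Mor A"
    and F: "is_functor A B F" and iso: "\<And>s. s \<in> S \<Longrightarrow> is_iso B (FMor F s)"
  shows "\<exists>!G. is_functor (loc A S) B G \<and> comp_fctr A G (loc_fctr A S) = F"
proof -
  have B: "category B" using F by (simp add: is_functor_def)
  have FOb: "FOb F X \<in> Ob B" if "X \<in> Ob A" for X using F that by (auto simp: is_functor_def)
  note FHom = is_functor_Hom[OF F]
  define inv where "inv s = (SOME g. g \<in> Hom B (FOb F (Cod A s)) (FOb F (Dom A s)) \<and>
    Comp B g (FMor F s) = Id B (FOb F (Dom A s)) \<and> Comp B (FMor F s) g = Id B (FOb F (Cod A s)))" for s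
  have inv: "inv s \<in> Hom B (FOb F Y) (FOb F X)" "Comp B (inv s) (FMor F s) = Id B (FOb F X)"
    "Comp B (FMor F s) (inv s) = Id B (FOb F Y)" if s: "s \<in> S" and sH: "s \<in> Hom A X Y" for s X Y
  proof -
    have "\<exists>g. g \<in> Hom B (FOb F (Cod A s)) (FOb F (Dom A s)) \<and>
      Comp B g (FMor F s) = Id B (FOb F (Dom A s)) \<and> Comp B (FMor F s) g = Id B (FOb F (Cod A s))"
      using iso[OF s] FHom[OF sH] sH unfolding is_iso_def Hom_def by auto
    from someI_ex[OF this, folded inv_def]
    show "inv s \<in> Hom B (FOb F Y) (FOb F X)" "Comp B (inv s) (FMor F s) = Id B (FOb F X)"
      "Comp B (FMor F s) (inv s) = Id B (FOb F Y)"
      using sH by (auto simp: Hom_def)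
  qed
  define ev where "ev = rec_list (\<lambda>X. Id B (FOb F X)) (\<lambda>e p r X. case e of
     Fwd f \<Rightarrow> Comp B (r (Cod A f)) (FMor F f) | Bwd s \<Rightarrow> Comp B (r (Dom A s)) (inv s))"
  have ev_simps: "ev [] X = Id B (FOb F X)" "ev (Fwd f # p) X = Comp B (ev p (Cod A f)) (FMor F f)"
    "ev (Bwd s # p) X = Comp B (ev p (Dom A s)) (inv s)" for X f s p
    by (simp_all add: ev_def)
  have SH: "s \<in> Hom A (Dom A s) (Cod A s)" if "s \<in> S" for s using that S by (auto simp: Hom_def)
  have MH: "f \<in> Hom A (Dom A f) (Cod A f)" if "f \<in> Mor A" for f using that by (auto simp: Hom_def)
  have ev_Hom: "ev p X \<in> Hom B (FOb F X) (FOb F Y)" if "path A S X p Y" for p X Y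
    using that
  proof (induction p arbitrary: X)
    case Nil
    then show ?case using category.Id_Hom[OF B FOb] by (auto simp: ev_simps)
  next
    case (Cons e p)
    show ?case
    proof (cases e)
      case (Fwd f)
      then show ?thesis using Cons category.Comp_Hom[OF B FHom[OF MH]] by (auto simp: ev_simps)
    next
      case (Bwd s)
      then show ?thesis using Cons category.Comp_Hom[OF B inv(1)[OF _ SH]] by (auto simp: ev_simps)
    qed
  qed
  have ev_append: "ev (p @ q) X = Comp B (ev q Y) (ev p X)" if "path A S X p Y" "path A S Y q Z" for p q X Y Z
    using that
  proof (induction p arbitrary: X)
    case Nil
    then show ?case using category.Comp_Id[OF B ev_Hom] by (auto simp: ev_simps)
  next
    case (Cons e p)
    show ?case
    proof (cases e)
      case (Fwd f)
      then show ?thesis using Cons category.Comp_assoc[OF B FHom[OF MH] ev_Hom ev_Hom]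
        by (auto simp: ev_simps)
    next
      case (Bwd s)
      then show ?thesis using Cons category.Comp_assoc[OF B inv(1)[OF _ SH] ev_Hom ev_Hom]
        by (auto simp: ev_simps)
    qed
  qed
  have ev_Fwd: "ev [Fwd f] X = FMor F f" if "f \<in> Hom A X Y" for f X Y
    using that category.Id_Comp[OF B FHom[OF that]] by (auto simp: ev_simps Hom_def)
  have ev_Bwd: "ev [Bwd s] Y = inv s" if "s \<in> S" "s \<in> Hom A X Y" for s X Y
    using that category.Id_Comp[OF B inv(1)[OF that]] by (auto simp: ev_simps Hom_def)
  have ev_eq: "path_eq A S X Y p q \<Longrightarrow> ev p X = ev q X" for X Y p q
  proof (induction rule: path_eq.induct)
    case (cong X Y p q Z p' q')
    then show ?case
      using path_eq_path[OF A S cong(1)] path_eq_path[OF A S cong(2)]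
        ev_append[of X p Y p' Z] ev_append[of X q Y q' Z] by simp
  next
    case (Fwd_Id X)
    then show ?case using ev_Fwd[OF category.Id_Hom[OF A]] F by (simp add: ev_simps is_functor_def)
  next
    case (Fwd_Comp f X Y g Z)
    then show ?case
      using ev_append[OF path_Fwd[OF A Fwd_Comp(1)] path_Fwd[OF A Fwd_Comp(2)]]
        category.Comp_Hom[OF A Fwd_Comp] by (simp add: ev_Fwd is_functor_Comp[OF F])
  next
    case (Fwd_Bwd s X Y)
    then show ?case
      using ev_append[OF path_Fwd[OF A Fwd_Bwd(2)] path_Bwd[OF A Fwd_Bwd]]
      by (simp add: ev_Fwd ev_Bwd inv) (simp add: ev_simps)
  next
    case (Bwd_Fwd s X Y)
    then show ?case
      using ev_append[OF path_Bwd[OF A Bwd_Fwd] path_Fwd[OF A Bwd_Fwd(2)]]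
      by (simp add: ev_Fwd ev_Bwd inv) (simp add: ev_simps)
  qed auto
  define G :: "('a, ('a, 'b) loc_mor, 'c, 'd) fctr" where
    "G = \<lparr>FOb = FOb F, FMor = (\<lambda>m \<in> Mor (loc A S). case m of (X, Y, P) \<Rightarrow> ev (SOME p. p \<in> P) X)\<rparr>"
  have G_class: "FMor G (path_class A S X Y p) = ev p X" if p: "path A S X p Y" for X Y p
  proof -
    have "path_eq A S X Y p (SOME q. path_eq A S X Y p q)"
      by (rule someI[of _ p], rule path_eq.refl[OF p])
    moreover have "path_class A S X Y p \<in> Mor (loc A S)" using loc_HomI[OF p] by (simp add: Hom_def)
    ultimately show ?thesis using ev_eq by (fastforce simp: G_def path_class_def)
  qed
  have L: "category (loc A S)" by (rule category_loc[OF A S])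
  have MorE: "\<exists>X Y p. path A S X p Y \<and> m = path_class A S X Y p" if "m \<in> Mor (loc A S)" for m
    using that by (auto simp: loc_def)
  have G: "is_functor (loc A S) B G"
    unfolding is_functor_def
  proof (intro conjI ballI impI)
    show "FOb G \<in> Ob (loc A S) \<rightarrow>\<^sub>E Ob B" using F by (simp add: G_def loc_simps is_functor_def)
    show "FMor G \<in> Mor (loc A S) \<rightarrow>\<^sub>E Mor B"
    proof (rule PiE_I)
      fix m assume "m \<in> Mor (loc A S)"
      then show "FMor G m \<in> Mor B" using ev_Hom G_class by (force dest!: MorE simp: Hom_def)
    qed (simp add: G_def)
  next
    fix m assume "m \<in> Mor (loc A S)"
    then obtain X Y p where m: "path A S X p Y" "m = path_class A S X Y p" using MorE by blast
    show "Dom B (FMor G m) = FOb G (Dom (loc A S) m)" "Cod B (FMor G m) = FOb G (Cod (loc A S) m)"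
      using ev_Hom[OF m(1)] unfolding m(2) G_class[OF m(1)] by (simp_all add: loc_simps Hom_def) (simp_all add: G_def)
  next
    fix X assume "X \<in> Ob (loc A S)"
    then show "FMor G (Id (loc A S) X) = Id B (FOb G X)"
      using G_class[of X "[]" X] by (simp add: loc_simps ev_simps) (simp add: G_def)
  next
    fix m n assume "m \<in> Mor (loc A S)" "n \<in> Mor (loc A S)" and eq: "Cod (loc A S) m = Dom (loc A S) n"
    then obtain X Y p Y' Z q where m: "path A S X p Y" "m = path_class A S X Y p"
      and n: "path A S Y' q Z" "n = path_class A S Y' Z q" using MorE by meson
    have [simp]: "Y' = Y" using eq by (simp add: m n loc_simps)
    show "FMor G (Comp (loc A S) n m) = Comp B (FMor G n) (FMor G m)"
      using m n path_append[OF A S m(1), of q Z] by (simp add: loc_Comp_class G_class ev_append)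
  qed (fact L B)+
  have Fext: "FOb F \<in> extensional (Ob A)" "FMor F \<in> extensional (Mor A)"
    using F by (auto simp: is_functor_def PiE_def)
  have GQ: "comp_fctr A G (loc_fctr A S) = F"
  proof -
    have "compose (Ob A) (FOb G) (FOb (loc_fctr A S)) = FOb F"
      by (rule extensionalityI[OF compose_extensional Fext(1)])
         (simp add: compose_def G_def loc_fctr_def)
    moreover have "compose (Mor A) (FMor G) (FMor (loc_fctr A S)) = FMor F"
      by (rule extensionalityI[OF compose_extensional Fext(2)])
         (simp add: compose_def loc_fctr_Hom[OF MH] G_class[OF path_Fwd[OF A MH]] ev_Fwd[OF MH])
    ultimately show ?thesis by (simp add: comp_fctr_def)
  qed
  have unique: "H = G" if H: "is_functor (loc A S) B H" and HQ: "comp_fctr A H (loc_fctr A S) = F" for H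
  proof -
    have HOb: "FOb H X = FOb F X" if "X \<in> Ob A" for X
      using arg_cong[OF HQ, of "\<lambda>F. FOb F X"] that by (simp add: comp_fctr_def compose_def loc_fctr_def)
    have HFwd: "FMor H (path_class A S X Y [Fwd f]) = FMor F f" if f: "f \<in> Hom A X Y" for f X Y
      using arg_cong[OF HQ, of "\<lambda>F. FMor F f"] f loc_fctr_Hom[OF f, of S]
      by (simp add: comp_fctr_def compose_def Hom_def)
    have HId: "FMor H (path_class A S X X []) = Id B (FOb F X)" if "X \<in> Ob A" for X
      using H that HOb[OF that] by (simp add: is_functor_def loc_simps)
    have HComp: "FMor H (path_class A S X Z (p @ q)) =
        Comp B (FMor H (path_class A S Y Z q)) (FMor H (path_class A S X Y p))"
      if "path A S X p Y" "path A S Y q Z" for X Y Z p q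
      using is_functor_Comp[OF H loc_HomI[OF that(1)] loc_HomI[OF that(2)]] that
      by (simp add: loc_Comp_class)
    have HBwd: "FMor H (path_class A S Y X [Bwd s]) = inv s" if s: "s \<in> S" and sH: "s \<in> Hom A X Y" for s X Y
    proof (rule inverse_unique[OF B FHom[OF sH] _ inv(1)[OF s sH] _ inv(3)[OF s sH]])
      have pf: "path A S X [Fwd s] Y" by (rule path_Fwd[OF A sH])
      have pg: "path A S Y [Bwd s] X" by (rule path_Bwd[OF A s sH])
      have XY: "X \<in> Ob A" "Y \<in> Ob A" using path_Ob[OF A S pf] by auto
      show "FMor H (path_class A S Y X [Bwd s]) \<in> Hom B (FOb F Y) (FOb F X)"
        using is_functor_Hom[OF H loc_HomI[OF pg]] by (simp add: HOb XY)
      have "path_class A S X X ([Fwd s] @ [Bwd s]) = path_class A S X X []"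
        using path_class_eqI[OF path_eq.Fwd_Bwd[OF s sH]] by simp
      then show "Comp B (FMor H (path_class A S Y X [Bwd s])) (FMor F s) = Id B (FOb F X)"
        using HComp[OF pf pg] HFwd[OF sH] HId[OF XY(1)] by simp
    qed
    have HP: "FMor H (path_class A S X Y p) = ev p X" if "path A S X p Y" for X Y p
      using that
    proof (induction p arbitrary: X)
      case Nil
      then show ?case by (auto simp: HId ev_simps)
    next
      case (Cons e p)
      show ?case
      proof (cases e)
        case (Fwd f)
        with Cons.prems have f: "f \<in> Hom A X (Cod A f)" and p: "path A S (Cod A f) p Y"
          by (auto simp: Hom_def)
        show ?thesis
          using HComp[OF path_Fwd[OF A f] p] by (simp add: Fwd ev_simps HFwd[OF f] Cons.IH[OF p])
      next
        case (Bwd s)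
        with Cons.prems have s: "s \<in> S" "s \<in> Hom A (Dom A s) X" and p: "path A S (Dom A s) p Y"
          using S by (auto simp: Hom_def)
        show ?thesis
          using HComp[OF path_Bwd[OF A s] p] by (simp add: Bwd ev_simps HBwd[OF s] Cons.IH[OF p])
      qed
    qed
    have "FOb H = FOb G"
    proof (rule extensionalityI)
      show "FOb H \<in> extensional (Ob A)" "FOb G \<in> extensional (Ob A)"
        using H G by (auto simp: is_functor_def loc_simps PiE_def)
    qed (simp add: HOb G_def)
    moreover have "FMor H = FMor G"
    proof (rule extensionalityI)
      show "FMor H \<in> extensional (Mor (loc A S))" "FMor G \<in> extensional (Mor (loc A S))"
        using H G by (auto simp: is_functor_def PiE_def)
    qed (auto dest!: MorE simp: HP G_class)
    ultimately show ?thesis by (simp)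
  qed
  show ?thesis using G GQ unique by blast
qed

end

theory Submission
  imports Defs
begin

text \<open>Under a right calculus of fractions, every morphism of \<open>A[S\<^sup>-\<^sup>1]\<close> is a fraction \<open>f s\<^sup>-\<^sup>1\<close>, two
  fractions have a common denominator, and \<open>f s\<^sup>-\<^sup>1 = g s\<^sup>-\<^sup>1\<close> holds exactly when \<open>f t = g t\<close> for some
  \<open>t \<in> S\<close>.  Each of these is an existence statement about single morphisms, so for a family indexed
  by \<open>I\<close> the witnesses can be chosen all at once and assembled into morphisms of \<open>A\<^sup>I\<close>.  Hence the
  classes of paths in \<open>A\<^sup>I\<close> are exactly the families of classes of paths in \<open>A\<close>
  (\<open>paths_componentwise\<close>), which says that \<open>\<Theta>\<^sub>I\<close> is bijective on morphisms; on objects it is the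
  identity.  Without a calculus of fractions this can break down for infinite \<open>I\<close>: the zigzags of a
  family may have unbounded lengths.

  The delicate step is the criterion for equality of fractions, which needs an invariant of the
  congruence defining the localization.  For it, a morphism \<open>w\<close> into the source of a path is lifted
  along the path: a forward edge composes, a backward edge \<open>s\<close> divides by \<open>s\<close>.  The Ore condition
  and the cancellation condition say that equivalent paths admit the same lifts up to precomposition
  with \<open>S\<close> (\<open>path_eq_refines\<close>).

  For the coproducts, the functor \<open>\<Coprod> : A\<^sup>I \<rightarrow> A\<close> is left adjoint to the diagonal, and closure of
  \<open>S\<close> under coproducts makes \<open>\<Coprod>\<close> act on path classes, as the diagonal does.  The adjunction therefore
  descends to the localizations, and as \<open>A\<^sup>I[(S\<^sup>I)\<^sup>-\<^sup>1]\<close> is \<open>(A[S\<^sup>-\<^sup>1])\<^sup>I\<close>, it exhibits the coproducts of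
  \<open>A\<close> as coproducts in \<open>A[S\<^sup>-\<^sup>1]\<close>.  This uses the calculus of fractions through
  \<open>paths_componentwise\<close> only, a property invariant under passing to opposite categories: reversal of
  paths identifies the localization of the opposite category with the opposite of the localization.
  So left calculi and products need no argument of their own.\<close>

section \<open>Paths and marked functors\<close>

lemma path_eq_prepend:
  "path_eq A S Y Z q r \<Longrightarrow> path A S X p Y \<Longrightarrow> path_eq A S X Z (p @ q) (p @ r)"
  by (rule path_eq.cong[OF path_eq.refl])

lemma path_eq_append:
  "path_eq A S X Y p q \<Longrightarrow> path A S Y r Z \<Longrightarrow> path_eq A S X Z (p @ r) (q @ r)"
  by (rule path_eq.cong[OF _ path_eq.refl])

lemma path_eq_Bwd_Cons_iff:
  assumes A: "category A" and s: "s \<in> S" "s \<in> Hom A W X"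
    and p: "path A S X p Y" and q: "path A S W q Y"
  shows "path_eq A S X Y p (Bwd s # q) \<longleftrightarrow> path_eq A S W Y (Fwd s # p) q"
proof
  assume "path_eq A S X Y p (Bwd s # q)"
  from path_eq_prepend[OF this path_Fwd[OF A s(2)]]
  have "path_eq A S W Y (Fwd s # p) (Fwd s # Bwd s # q)" by simp
  moreover have "path_eq A S W Y (Fwd s # Bwd s # q) q"
    using path_eq_append[OF path_eq.Fwd_Bwd[OF s] q] by simp
  ultimately show "path_eq A S W Y (Fwd s # p) q" by (rule path_eq.trans)
next
  assume "path_eq A S W Y (Fwd s # p) q"
  from path_eq_prepend[OF this path_Bwd[OF A s]]
  have "path_eq A S X Y (Bwd s # Fwd s # p) (Bwd s # q)" by simp
  moreover have "path_eq A S X Y p (Bwd s # Fwd s # p)"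
    using path_eq.sym[OF path_eq_append[OF path_eq.Bwd_Fwd[OF s] p]] by simp
  ultimately show "path_eq A S X Y p (Bwd s # q)" by (rule path_eq.trans[rotated])
qed

lemma path_eq_cancel_Fwd:
  assumes A: "category A" and s: "s \<in> S" "s \<in> Hom A W X"
    and p: "path A S X p Y" and q: "path A S X q Y"
    and eq: "path_eq A S W Y (Fwd s # p) (Fwd s # q)"
  shows "path_eq A S X Y p q"
proof -
  have "path A S W (Fwd s # q) Y" using s(2) q by (auto simp: Hom_def)
  then have "path_eq A S X Y p (Bwd s # Fwd s # q)"
    using path_eq_Bwd_Cons_iff[OF A s p] eq by blast
  moreover have "path_eq A S X Y (Bwd s # Fwd s # q) q"
    using path_eq_append[OF path_eq.Bwd_Fwd[OF s] q] by simp
  ultimately show ?thesis by (rule path_eq.trans)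
qed

text \<open>A functor carrying \<open>S\<close> into \<open>T\<close>, given by bare maps on objects and morphisms.  Extensionality is
  left out so that projections, diagonals and composites can be written as plain \<open>\<lambda>\<close>-terms.\<close>

definition marked_functor :: "('o, 'm) cat \<Rightarrow> 'm set \<Rightarrow> ('p, 'n) cat \<Rightarrow> 'n set \<Rightarrow>
    ('o \<Rightarrow> 'p) \<Rightarrow> ('m \<Rightarrow> 'n) \<Rightarrow> bool" where
  "marked_functor A S B T FO FM \<longleftrightarrow>
    (\<forall>X \<in> Ob A. FO X \<in> Ob B \<and> FM (Id A X) = Id B (FO X)) \<and>
    (\<forall>X Y f. f \<in> Hom A X Y \<longrightarrow> FM f \<in> Hom B (FO X) (FO Y)) \<and>
    (\<forall>X Y Z f g. f \<in> Hom A X Y \<longrightarrow> g \<in> Hom A Y Z \<longrightarrow> FM (g \<cdot>\<^bsub>A\<^esub> f) = FM g \<cdot>\<^bsub>B\<^esub> FM f) \<and>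
    (\<forall>s \<in> S. FM s \<in> T)"

abbreviation map_path :: "('m \<Rightarrow> 'n) \<Rightarrow> 'm edge list \<Rightarrow> 'n edge list" where
  "map_path F \<equiv> map (map_edge F)"

context
  fixes A :: "('o, 'm) cat" and S and B :: "('p, 'n) cat" and T
  assumes A: "category A" and S: "S \<subseteq> Mor A" and B: "category B" and T: "T \<subseteq> Mor B"
begin

lemma path_map_path:
  assumes F: "marked_functor A S B T FO FM"
  shows "path A S X p Y \<Longrightarrow> path B T (FO X) (map_path FM p) (FO Y)"
proof (induction p arbitrary: X)
  case Nil
  then show ?case using F by (auto simp: marked_functor_def)
next
  case (Cons e p)
  have H: "FM f \<in> Hom B (FO (Dom A f)) (FO (Cod A f))" if "f \<in> Mor A" for f
    using F that by (auto simp: marked_functor_def Hom_def)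
  show ?case
    using Cons H S F by (cases e) (auto simp: Hom_def marked_functor_def)
qed

lemma path_eq_map_path:
  assumes F: "marked_functor A S B T FO FM"
  shows "path_eq A S X Y p q \<Longrightarrow> path_eq B T (FO X) (FO Y) (map_path FM p) (map_path FM q)"
proof (induction rule: path_eq.induct)
  case (refl X p Y)
  then show ?case by (intro path_eq.refl path_map_path[OF F])
next
  case (sym X Y p q)
  show ?case by (rule path_eq.sym[OF sym(2)])
next
  case (trans X Y p q r)
  then show ?case by (blast intro: path_eq.trans)
next
  case (cong X Y p q Z p' q')
  then show ?case by (simp add: path_eq.cong)
next
  case (Fwd_Id X)
  then show ?case using F by (simp add: marked_functor_def path_eq.Fwd_Id)
next
  case (Fwd_Comp f X Y g Z)
  then have "FM (g \<cdot>\<^bsub>A\<^esub> f) = FM g \<cdot>\<^bsub>B\<^esub> FM f" "FM f \<in> Hom B (FO X) (FO Y)" "FM g \<in> Hom B (FO Y) (FO Z)"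
    using F unfolding marked_functor_def by blast+
  then show ?case by (simp add: path_eq.Fwd_Comp)
next
  case (Fwd_Bwd s X Y)
  then have "FM s \<in> T" "FM s \<in> Hom B (FO X) (FO Y)" using F unfolding marked_functor_def by blast+
  then show ?case by (simp add: path_eq.Fwd_Bwd)
next
  case (Bwd_Fwd s X Y)
  then have "FM s \<in> T" "FM s \<in> Hom B (FO X) (FO Y)" using F unfolding marked_functor_def by blast+
  then show ?case by (simp add: path_eq.Bwd_Fwd)
qed

text \<open>A natural transformation between marked functors stays natural along the formal inverses, hence
  along arbitrary paths.\<close>

lemma path_eq_natural:
  assumes F: "marked_functor A S B T FO FM" and G: "marked_functor A S B T GO GM"
    and \<eta>: "\<And>X. X \<in> Ob A \<Longrightarrow> \<eta> X \<in> Hom B (FO X) (GO X)"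
    and nat: "\<And>X Y f. f \<in> Hom A X Y \<Longrightarrow> \<eta> Y \<cdot>\<^bsub>B\<^esub> FM f = GM f \<cdot>\<^bsub>B\<^esub> \<eta> X"
  shows "path A S X p Y \<Longrightarrow>
    path_eq B T (FO X) (GO Y) (map_path FM p @ [Fwd (\<eta> Y)]) (Fwd (\<eta> X) # map_path GM p)"
proof (induction p arbitrary: X)
  case Nil
  then have "Y \<in> Ob A" "X = Y" by auto
  then show ?case using path_eq.refl[OF path_Fwd[OF B \<eta>[of Y]], of T] by simp
next
  case (Cons e p)
  have square: "path_eq B T (FO X) (GO Y) [Fwd (FM f), Fwd (\<eta> Y)] [Fwd (\<eta> X), Fwd (GM f)]"
    if f: "f \<in> Hom A X Y" for X Y f
  proof -
    have "X \<in> Ob A" "Y \<in> Ob A"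
      using f category.Dom_Ob[OF A] category.Cod_Ob[OF A] by (auto simp: Hom_def)
    note h = \<eta>[OF this(1)] \<eta>[OF this(2)]
    have "FM f \<in> Hom B (FO X) (FO Y)" "GM f \<in> Hom B (GO X) (GO Y)"
      using F G f unfolding marked_functor_def by blast+
    from path_eq.Fwd_Comp[OF this(1) h(2), where S = T] path_eq.Fwd_Comp[OF h(1) this(2), where S = T]
    show ?thesis unfolding nat[OF f] by (blast intro: path_eq.sym path_eq.trans)
  qed
  show ?case
  proof (cases e)
    case (Fwd f)
    with Cons.prems have f: "f \<in> Hom A X (Cod A f)" and p: "path A S (Cod A f) p Y"
      by (auto simp: Hom_def)
    have Ff: "FM f \<in> Hom B (FO X) (FO (Cod A f))" using F f unfolding marked_functor_def by blast
    show ?thesis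
      using path_eq.trans[OF path_eq_prepend[OF Cons.IH[OF p] path_Fwd[OF B Ff]]]
        path_eq_append[OF square[OF f] path_map_path[OF G p]] by (simp add: Fwd)
  next
    case (Bwd s)
    define X' where "X' = Dom A s"
    from Cons.prems Bwd have s: "s \<in> S" "s \<in> Hom A X' X" and p: "path A S X' p Y"
      using S by (auto simp: X'_def Hom_def)
    have Fs: "FM s \<in> T" "FM s \<in> Hom B (FO X') (FO X)" using F s unfolding marked_functor_def by blast+
    have Gs: "GM s \<in> T" "GM s \<in> Hom B (GO X') (GO X)" using G s unfolding marked_functor_def by blast+
    have ob: "X' \<in> Ob A" "X \<in> Ob A"
      using path_Ob[OF A S p] path_Ob[OF A S Cons.prems] by auto
    note hX = path_Fwd[OF B \<eta>[OF ob(2)], of T] and hX' = path_Fwd[OF B \<eta>[OF ob(1)], of T]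
    note pFs = path_Bwd[OF B Fs] and pGs = path_Bwd[OF B Gs]
    \<comment> \<open>The naturality square of \<open>s\<close> is conjugated by the formal inverses of its two images.\<close>
    have "path_eq B T (FO X') (GO X') ([Fwd (FM s), Fwd (\<eta> X)] @ [Bwd (GM s)]) [Fwd (\<eta> X')]"
      using path_eq.trans[OF path_eq_append[OF square[OF s(2)] pGs], of "[Fwd (\<eta> X')]"]
        path_eq_prepend[OF path_eq.Fwd_Bwd[OF Gs] hX'] by simp
    then have "path_eq B T (FO X) (GO X') [Fwd (\<eta> X), Bwd (GM s)] [Bwd (FM s), Fwd (\<eta> X')]"
      using iffD2[OF path_eq_Bwd_Cons_iff[OF B Fs path_append[OF B T hX pGs] hX']] by simp
    from path_eq_append[OF path_eq.sym[OF this] path_map_path[OF G p]]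
    have "path_eq B T (FO X) (GO Y) (Bwd (FM s) # Fwd (\<eta> X') # map_path GM p)
      (Fwd (\<eta> X) # Bwd (GM s) # map_path GM p)" by simp
    from path_eq.trans[OF path_eq_prepend[OF Cons.IH[OF p] pFs, simplified] this]
    show ?thesis by (simp add: Bwd)
  qed
qed

end

section \<open>Opposite categories\<close>

definition opp :: "('o, 'm) cat \<Rightarrow> ('o, 'm) cat" where
  "opp A = \<lparr>Ob = Ob A, Mor = Mor A, Dom = Cod A, Cod = Dom A, Id = Id A,
    Comp = (\<lambda>g f. f \<cdot>\<^bsub>A\<^esub> g)\<rparr>"

lemma opp_simps [simp]:
  "Ob (opp A) = Ob A" "Mor (opp A) = Mor A" "Dom (opp A) = Cod A" "Cod (opp A) = Dom A"
  "Id (opp A) = Id A" "g \<cdot>\<^bsub>opp A\<^esub> f = f \<cdot>\<^bsub>A\<^esub> g" "opp (opp A) = A"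
  by (simp_all add: opp_def)

lemma Hom_opp [simp]: "Hom (opp A) X Y = Hom A Y X"
  by (auto simp: Hom_def)

lemma category_opp: "category A \<Longrightarrow> category (opp A)"
  unfolding category_def[of "opp A"]
  by (auto simp: category.Dom_Ob category.Cod_Ob category.Id_Hom category.Comp_Hom
      category.Comp_Id category.Id_Comp category.Comp_assoc)

lemma left_calculus_opp: "left_calculus A S \<longleftrightarrow> right_calculus (opp A) S"
  unfolding left_calculus_def right_calculus_def by auto

lemma power_cat_opp: "power_cat I (opp A) = opp (power_cat I A)"
  by (simp add: power_cat_def opp_def)

lemma is_product_opp: "is_product I A X P p \<longleftrightarrow> is_coproduct I (opp A) X P p"
  by (simp add: is_product_def is_coproduct_def)

text \<open>In the opposite category a morphism \<open>X i \<rightarrow> Y i\<close> runs from \<open>Y i\<close> to \<open>X i\<close>, so the two closure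
  conditions agree after the two families are interchanged.\<close>

lemma closed_under_products_opp:
  "closed_under_products I A S \<longleftrightarrow> closed_under_coproducts I (opp A) S"
  unfolding closed_under_products_def closed_under_coproducts_def is_product_opp
  by (simp, intro ex_cong1 conj_cong[OF HOL.refl]) blast

text \<open>A forward edge of \<open>A\<close> is a forward edge of the opposite category traversed the other way, and
  likewise for backward edges; so dualizing a path only reverses the list and leaves the edges alone.\<close>

lemma path_rev:
  assumes A: "category A" and S: "S \<subseteq> Mor A"
  shows "path A S X p Y \<Longrightarrow> path (opp A) S Y (rev p) X"
proof (induction p arbitrary: X)
  case (Cons e p)
  have S': "S \<subseteq> Mor (opp A)" using S by simp
  have "\<exists>Z. path A S Z p Y \<and> path (opp A) S Z [e] X"
    using Cons.prems S category.Dom_Ob[OF A] category.Cod_Ob[OF A] by (cases e) auto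
  then obtain Z where "path A S Z p Y" "path (opp A) S Z [e] X" by blast
  then show ?case using path_append[OF category_opp[OF A] S' Cons.IH] by simp
qed auto

lemma path_eq_rev:
  assumes A: "category A" and S: "S \<subseteq> Mor A"
  shows "path_eq A S X Y p q \<Longrightarrow> path_eq (opp A) S Y X (rev p) (rev q)"
proof (induction rule: path_eq.induct)
  case (refl X p Y)
  then show ?case by (intro path_eq.refl path_rev[OF A S])
next
  case (sym X Y p q)
  show ?case by (rule path_eq.sym[OF sym(2)])
next
  case (trans X Y p q r)
  then show ?case by (blast intro: path_eq.trans)
next
  case (cong X Y p q Z p' q')
  then show ?case by (simp add: path_eq.cong)
next
  case (Fwd_Id X)
  then show ?case using path_eq.Fwd_Id[of X "opp A" S] by simp
next
  case (Fwd_Comp f X Y g Z)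
  then show ?case using path_eq.Fwd_Comp[of g "opp A" Z Y f X S] by simp
next
  case (Fwd_Bwd s X Y)
  then show ?case using path_eq.Bwd_Fwd[of s S "opp A" Y X] by simp
next
  case (Bwd_Fwd s X Y)
  then show ?case using path_eq.Fwd_Bwd[of s S "opp A" Y X] by simp
qed

section \<open>Right fractions\<close>

text \<open>\<open>lifts A w p f\<close>: the morphism \<open>w\<close> into the source of \<open>p\<close> can be carried along \<open>p\<close> inside \<open>A\<close>, with
  result \<open>f\<close>.  In the localization this forces \<open>p \<circ> w = f\<close>.  A quotient by \<open>s\<close> need neither
  exist nor be unique, hence a relation.\<close>

fun lifts :: "('o, 'm) cat \<Rightarrow> 'm \<Rightarrow> 'm edge list \<Rightarrow> 'm \<Rightarrow> bool" where
  "lifts A w [] f \<longleftrightarrow> f = w"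
| "lifts A w (Fwd g # p) f \<longleftrightarrow> lifts A (g \<cdot>\<^bsub>A\<^esub> w) p f"
| "lifts A w (Bwd s # p) f \<longleftrightarrow> (\<exists>v \<in> Hom A (Dom A w) (Dom A s). s \<cdot>\<^bsub>A\<^esub> v = w \<and> lifts A v p f)"

text \<open>Mutual refinement means that two paths starting at \<open>X\<close> act in the same way on the filtered
  colimits of the sets \<open>Hom A V X\<close> over all \<open>V \<rightarrow> W\<close> in \<open>S\<close>; stating it on representatives avoids
  these quotients.\<close>

definition refines :: "('o, 'm) cat \<Rightarrow> 'm set \<Rightarrow> 'o \<Rightarrow> 'm edge list \<Rightarrow> 'm edge list \<Rightarrow> bool" where
  "refines A S X p q \<longleftrightarrow> (\<forall>W w f. w \<in> Hom A W X \<longrightarrow> lifts A w p f \<longrightarrow>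
    (\<exists>V t. t \<in> S \<inter> Hom A V W \<and> lifts A (w \<cdot>\<^bsub>A\<^esub> t) q (f \<cdot>\<^bsub>A\<^esub> t)))"

lemma lifts_append: "lifts A w (p @ q) f \<longleftrightarrow> (\<exists>m. lifts A w p m \<and> lifts A m q f)"
  by (induction A w p f rule: lifts.induct) auto

context
  fixes A :: "('o, 'm) cat" and S
  assumes A: "category A" and S: "S \<subseteq> Mor A"
begin

lemma lifts_Hom:
  "path A S X p Y \<Longrightarrow> w \<in> Hom A W X \<Longrightarrow> lifts A w p f \<Longrightarrow> f \<in> Hom A W Y"
proof (induction p arbitrary: w X)
  case (Cons e p)
  show ?case
  proof (cases e)
    case (Fwd g)
    then show ?thesis
      using Cons.IH[of "Cod A g" "g \<cdot>\<^bsub>A\<^esub> w"] Cons.prems category.Comp_Hom[OF A, of w W X g "Cod A g"]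
      by (simp add: Hom_def)
  next
    case (Bwd s)
    with Cons.prems obtain v where "v \<in> Hom A W (Dom A s)" "lifts A v p f" by (auto simp: Hom_def)
    then show ?thesis using Cons.IH[of "Dom A s" v] Cons.prems by (simp add: Bwd)
  qed
qed auto

lemma lifts_precomp:
  assumes t: "t \<in> Hom A V W"
  shows "path A S X p Y \<Longrightarrow> w \<in> Hom A W X \<Longrightarrow> lifts A w p f \<Longrightarrow>
    lifts A (w \<cdot>\<^bsub>A\<^esub> t) p (f \<cdot>\<^bsub>A\<^esub> t)"
proof (induction p arbitrary: w X)
  case (Cons e p)
  show ?case
  proof (cases e)
    case (Fwd g)
    with Cons.prems have g: "g \<in> Hom A X (Cod A g)" by (auto simp: Hom_def)
    show ?thesis
      using Cons.IH[OF _ category.Comp_Hom[OF A Cons.prems(2) g]] Cons.prems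
        category.Comp_assoc[OF A t Cons.prems(2) g] by (simp add: Fwd)
  next
    case (Bwd s)
    with Cons.prems S have s: "s \<in> Hom A (Dom A s) X" by (auto simp: Hom_def)
    from Cons.prems Bwd obtain v where v: "v \<in> Hom A W (Dom A s)" "s \<cdot>\<^bsub>A\<^esub> v = w" "lifts A v p f"
      by (auto simp: Hom_def)
    have "lifts A (v \<cdot>\<^bsub>A\<^esub> t) p (f \<cdot>\<^bsub>A\<^esub> t)" using Cons.IH[OF _ v(1,3)] Cons.prems by (simp add: Bwd)
    moreover have "s \<cdot>\<^bsub>A\<^esub> (v \<cdot>\<^bsub>A\<^esub> t) = w \<cdot>\<^bsub>A\<^esub> t" using category.Comp_assoc[OF A t v(1) s] v(2) by simp
    moreover have "v \<cdot>\<^bsub>A\<^esub> t \<in> Hom A V (Dom A s)" by (rule category.Comp_Hom[OF A t v(1)])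
    moreover have "Dom A (w \<cdot>\<^bsub>A\<^esub> t) = V"
      using category.Comp_Hom[OF A t Cons.prems(2)] by (simp add: Hom_def)
    ultimately show ?thesis by (auto simp: Bwd)
  qed
qed auto

lemma path_eq_lifts:
  "path A S X p Y \<Longrightarrow> w \<in> Hom A W X \<Longrightarrow> lifts A w p f \<Longrightarrow> path_eq A S W Y (Fwd w # p) [Fwd f]"
proof (induction p arbitrary: w X)
  case Nil
  then show ?case using path_eq.refl[OF path_Fwd[OF A Nil.prems(2), of S]] by simp
next
  case (Cons e p)
  show ?case
  proof (cases e)
    case (Fwd g)
    with Cons.prems have g: "g \<in> Hom A X (Cod A g)" and p: "path A S (Cod A g) p Y"
      by (auto simp: Hom_def)
    have "path_eq A S W Y (Fwd w # Fwd g # p) (Fwd (g \<cdot>\<^bsub>A\<^esub> w) # p)"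
      using path_eq_append[OF path_eq.Fwd_Comp[OF Cons.prems(2) g] p] by simp
    then show ?thesis
      using path_eq.trans Cons.IH[OF p category.Comp_Hom[OF A Cons.prems(2) g]] Cons.prems(3)
      by (fastforce simp: Fwd)
  next
    case (Bwd s)
    with Cons.prems S have s: "s \<in> S" "s \<in> Hom A (Dom A s) X" and p: "path A S (Dom A s) p Y"
      by (auto simp: Hom_def)
    from Cons.prems Bwd obtain v where v: "v \<in> Hom A W (Dom A s)" "s \<cdot>\<^bsub>A\<^esub> v = w" "lifts A v p f"
      by (auto simp: Hom_def)
    have "path_eq A S W X [Fwd w] [Fwd v, Fwd s]"
      using path_eq.sym[OF path_eq.Fwd_Comp[OF v(1) s(2)]] v(2) by simp
    from path_eq_append[OF this path_append[OF A S path_Bwd[OF A s] p]]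
    have "path_eq A S W Y (Fwd w # Bwd s # p) (Fwd v # Fwd s # Bwd s # p)" by simp
    moreover have "path_eq A S W Y (Fwd v # Fwd s # Bwd s # p) (Fwd v # p)"
      using path_eq_prepend[OF path_eq_append[OF path_eq.Fwd_Bwd[OF s] p] path_Fwd[OF A v(1)]] by simp
    ultimately show ?thesis using Cons.IH[OF p v(1,3)] by (auto simp: Bwd intro: path_eq.trans)
  qed
qed

end

lemma right_calculus_ore:
  assumes "right_calculus A S" "f \<in> Hom A X Y" "s \<in> S \<inter> Hom A Y' Y"
  obtains X' t f' where "t \<in> S \<inter> Hom A X' X" "f' \<in> Hom A X' Y'" "s \<cdot>\<^bsub>A\<^esub> f' = f \<cdot>\<^bsub>A\<^esub> t"
  using assms unfolding right_calculus_def by meson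

lemma right_calculus_cancel:
  assumes "right_calculus A S" "f \<in> Hom A X Y" "g \<in> Hom A X Y" "s \<in> S \<inter> Hom A Y Y'" "s \<cdot>\<^bsub>A\<^esub> f = s \<cdot>\<^bsub>A\<^esub> g"
  obtains X' t where "t \<in> S \<inter> Hom A X' X" "f \<cdot>\<^bsub>A\<^esub> t = g \<cdot>\<^bsub>A\<^esub> t"
  using assms unfolding right_calculus_def by meson

context
  fixes A :: "('o, 'm) cat" and S
  assumes A: "category A" and S: "S \<subseteq> Mor A" and R: "right_calculus A S"
begin

lemma right_calculus_Id: "X \<in> Ob A \<Longrightarrow> Id A X \<in> S \<inter> Hom A X X"
  using R category.Id_Hom[OF A] by (auto simp: right_calculus_def)

lemma right_calculus_Comp:
  assumes "s \<in> S \<inter> Hom A X Y" "t \<in> S \<inter> Hom A Y Z"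
  shows "t \<cdot>\<^bsub>A\<^esub> s \<in> S \<inter> Hom A X Z"
  using assms R category.Comp_Hom[OF A] by (auto simp: right_calculus_def Hom_def)

lemma refinesI_lifts:
  assumes p: "path A S X p Y" and "\<And>W w f. w \<in> Hom A W X \<Longrightarrow> lifts A w p f \<Longrightarrow> lifts A w q f"
  shows "refines A S X p q"
  unfolding refines_def
proof (intro allI impI)
  fix W w f assume w: "w \<in> Hom A W X" "lifts A w p f"
  have f: "f \<in> Hom A W Y" by (rule lifts_Hom[OF A S p w])
  have "W \<in> Ob A" using w(1) category.Dom_Ob[OF A] by (auto simp: Hom_def)
  then have "Id A W \<in> S \<inter> Hom A W W" by (rule right_calculus_Id)
  moreover have "w \<cdot>\<^bsub>A\<^esub> Id A W = w" "f \<cdot>\<^bsub>A\<^esub> Id A W = f" using w f category.Comp_Id[OF A] by auto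
  ultimately show "\<exists>V t. t \<in> S \<inter> Hom A V W \<and> lifts A (w \<cdot>\<^bsub>A\<^esub> t) q (f \<cdot>\<^bsub>A\<^esub> t)"
    using assms(2)[OF w] by metis
qed

lemma refines_trans:
  assumes p: "path A S X p Y" and pq: "refines A S X p q" and qr: "refines A S X q r"
  shows "refines A S X p r"
  unfolding refines_def
proof (intro allI impI)
  fix W w f assume w: "w \<in> Hom A W X" "lifts A w p f"
  have f: "f \<in> Hom A W Y" by (rule lifts_Hom[OF A S p w])
  obtain V t where t: "t \<in> S \<inter> Hom A V W" "lifts A (w \<cdot>\<^bsub>A\<^esub> t) q (f \<cdot>\<^bsub>A\<^esub> t)"
    using pq w unfolding refines_def by blast
  have "w \<cdot>\<^bsub>A\<^esub> t \<in> Hom A V X" using category.Comp_Hom[OF A _ w(1)] t(1) by auto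
  then obtain V' t' where t': "t' \<in> S \<inter> Hom A V' V"
      "lifts A (w \<cdot>\<^bsub>A\<^esub> t \<cdot>\<^bsub>A\<^esub> t') r (f \<cdot>\<^bsub>A\<^esub> t \<cdot>\<^bsub>A\<^esub> t')"
    using qr t(2) unfolding refines_def by blast
  have "w \<cdot>\<^bsub>A\<^esub> t \<cdot>\<^bsub>A\<^esub> t' = w \<cdot>\<^bsub>A\<^esub> (t \<cdot>\<^bsub>A\<^esub> t')" "f \<cdot>\<^bsub>A\<^esub> t \<cdot>\<^bsub>A\<^esub> t' = f \<cdot>\<^bsub>A\<^esub> (t \<cdot>\<^bsub>A\<^esub> t')"
    using category.Comp_assoc[OF A, of t' V' V t W w X] category.Comp_assoc[OF A, of t' V' V t W f Y]
      t t' w f by auto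
  then show "\<exists>V t. t \<in> S \<inter> Hom A V W \<and> lifts A (w \<cdot>\<^bsub>A\<^esub> t) r (f \<cdot>\<^bsub>A\<^esub> t)"
    using right_calculus_Comp[OF t'(1) t(1)] t'(2) by metis
qed

lemma refines_append:
  assumes p: "path A S X p Y" and p': "path A S Y p' Z" and q: "path A S X q Y"
    and pq: "refines A S X p q" and pq': "refines A S Y p' q'"
  shows "refines A S X (p @ p') (q @ q')"
  unfolding refines_def
proof (intro allI impI)
  fix W w f assume w: "w \<in> Hom A W X" and "lifts A w (p @ p') f"
  then obtain m where m: "lifts A w p m" "lifts A m p' f" by (auto simp: lifts_append)
  have mH: "m \<in> Hom A W Y" by (rule lifts_Hom[OF A S p w m(1)])
  have f: "f \<in> Hom A W Z" by (rule lifts_Hom[OF A S p' mH m(2)])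
  obtain V t where t: "t \<in> S \<inter> Hom A V W" "lifts A (w \<cdot>\<^bsub>A\<^esub> t) q (m \<cdot>\<^bsub>A\<^esub> t)"
    using pq w m(1) unfolding refines_def by blast
  have wt: "w \<cdot>\<^bsub>A\<^esub> t \<in> Hom A V X" and mt: "m \<cdot>\<^bsub>A\<^esub> t \<in> Hom A V Y"
    using category.Comp_Hom[OF A _ w] category.Comp_Hom[OF A _ mH] t(1) by auto
  have "lifts A (m \<cdot>\<^bsub>A\<^esub> t) p' (f \<cdot>\<^bsub>A\<^esub> t)" using lifts_precomp[OF A S _ p' mH m(2)] t(1) by blast
  then obtain V' t' where t': "t' \<in> S \<inter> Hom A V' V"
      "lifts A (m \<cdot>\<^bsub>A\<^esub> t \<cdot>\<^bsub>A\<^esub> t') q' (f \<cdot>\<^bsub>A\<^esub> t \<cdot>\<^bsub>A\<^esub> t')"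
    using pq' mt unfolding refines_def by blast
  have "lifts A (w \<cdot>\<^bsub>A\<^esub> t \<cdot>\<^bsub>A\<^esub> t') q (m \<cdot>\<^bsub>A\<^esub> t \<cdot>\<^bsub>A\<^esub> t')"
    using lifts_precomp[OF A S _ q wt t(2)] t'(1) by blast
  then have "lifts A (w \<cdot>\<^bsub>A\<^esub> t \<cdot>\<^bsub>A\<^esub> t') (q @ q') (f \<cdot>\<^bsub>A\<^esub> t \<cdot>\<^bsub>A\<^esub> t')"
    using t'(2) by (auto simp: lifts_append)
  moreover have "w \<cdot>\<^bsub>A\<^esub> t \<cdot>\<^bsub>A\<^esub> t' = w \<cdot>\<^bsub>A\<^esub> (t \<cdot>\<^bsub>A\<^esub> t')" "f \<cdot>\<^bsub>A\<^esub> t \<cdot>\<^bsub>A\<^esub> t' = f \<cdot>\<^bsub>A\<^esub> (t \<cdot>\<^bsub>A\<^esub> t')"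
    using category.Comp_assoc[OF A, of t' V' V t W w X] category.Comp_assoc[OF A, of t' V' V t W f Z]
      t t' w f by auto
  ultimately show "\<exists>V t. t \<in> S \<inter> Hom A V W \<and> lifts A (w \<cdot>\<^bsub>A\<^esub> t) (q @ q') (f \<cdot>\<^bsub>A\<^esub> t)"
    using right_calculus_Comp[OF t'(1) t(1)] by metis
qed

text \<open>Lifts are an invariant of path classes.  Functoriality of \<open>Fwd\<close> preserves lifts on the nose.  From
  \<open>[Fwd s, Bwd s]\<close> one can arrive at any \<open>f\<close> with \<open>s f = s w\<close>, and cancellation identifies \<open>f\<close> with
  \<open>w\<close> after precomposing with \<open>S\<close>.  To lift along \<open>[Bwd s, Fwd s]\<close>, the quotient by \<open>s\<close> must
  exist after such a precomposition: this is the Ore condition.\<close>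

lemma path_eq_refines:
  "path_eq A S X Y p q \<Longrightarrow> refines A S X p q \<and> refines A S X q p"
proof (induction rule: path_eq.induct)
  case (refl X p Y)
  then show ?case using refinesI_lifts by blast
next
  case (sym X Y p q)
  then show ?case by blast
next
  case (trans X Y p q r)
  then show ?case using path_eq_path[OF A S trans(1)] path_eq_path[OF A S trans(2)] refines_trans by blast
next
  case (cong X Y p q Z p' q')
  then show ?case
    using path_eq_path[OF A S cong(1)] path_eq_path[OF A S cong(2)] refines_append by blast
next
  case (Fwd_Id X)
  note path = path_eq_path[OF A S path_eq.Fwd_Id[OF Fwd_Id]]
  show ?case
    using refinesI_lifts[OF conjunct1[OF path]] refinesI_lifts[OF conjunct2[OF path]]
    by (simp add: category.Id_Comp[OF A])
next
  case (Fwd_Comp f X Y g Z)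
  note path = path_eq_path[OF A S path_eq.Fwd_Comp[OF Fwd_Comp]]
  show ?case
    using refinesI_lifts[OF conjunct1[OF path]] refinesI_lifts[OF conjunct2[OF path]]
    by (simp add: category.Comp_assoc[OF A _ Fwd_Comp])
next
  case (Fwd_Bwd s X Y)
  note path = path_eq_path[OF A S path_eq.Fwd_Bwd[OF Fwd_Bwd]]
  have "refines A S X [Fwd s, Bwd s] []"
    unfolding refines_def
  proof (intro allI impI)
    fix W w f assume w: "w \<in> Hom A W X" and "lifts A w [Fwd s, Bwd s] f"
    then have f: "f \<in> Hom A W X" "s \<cdot>\<^bsub>A\<^esub> f = s \<cdot>\<^bsub>A\<^esub> w"
      using category.Comp_Hom[OF A w Fwd_Bwd(2)] Fwd_Bwd(2) by (auto simp: Hom_def)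
    obtain V t where "t \<in> S \<inter> Hom A V W" "f \<cdot>\<^bsub>A\<^esub> t = w \<cdot>\<^bsub>A\<^esub> t"
      using right_calculus_cancel[OF R f(1) w _ f(2)] Fwd_Bwd by blast
    then show "\<exists>V t. t \<in> S \<inter> Hom A V W \<and> lifts A (w \<cdot>\<^bsub>A\<^esub> t) [] (f \<cdot>\<^bsub>A\<^esub> t)" by auto
  qed
  moreover have "lifts A w [Fwd s, Bwd s] w" if w: "w \<in> Hom A W X" for W w
    using w category.Comp_Hom[OF A w Fwd_Bwd(2)] Fwd_Bwd(2) by (auto simp: Hom_def)
  ultimately show ?case using refinesI_lifts[OF conjunct2[OF path]] by simp
next
  case (Bwd_Fwd s X Y)
  note path = path_eq_path[OF A S path_eq.Bwd_Fwd[OF Bwd_Fwd]]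
  have "refines A S Y [] [Bwd s, Fwd s]"
    unfolding refines_def
  proof (intro allI impI)
    fix W w f assume w: "w \<in> Hom A W Y" and "lifts A w [] f"
    then have f: "f = w" by simp
    obtain V t v where t: "t \<in> S \<inter> Hom A V W" and v: "v \<in> Hom A V X" "s \<cdot>\<^bsub>A\<^esub> v = w \<cdot>\<^bsub>A\<^esub> t"
      using right_calculus_ore[OF R w IntI[OF Bwd_Fwd]] by blast
    have "w \<cdot>\<^bsub>A\<^esub> t \<in> Hom A V Y" using t category.Comp_Hom[OF A _ w] by blast
    then have "lifts A (w \<cdot>\<^bsub>A\<^esub> t) [Bwd s, Fwd s] (w \<cdot>\<^bsub>A\<^esub> t)"
      using v Bwd_Fwd(2) by (auto simp: Hom_def)
    with t show "\<exists>V t. t \<in> S \<inter> Hom A V W \<and> lifts A (w \<cdot>\<^bsub>A\<^esub> t) [Bwd s, Fwd s] (f \<cdot>\<^bsub>A\<^esub> t)"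
      unfolding f by blast
  qed
  moreover have "refines A S Y [Bwd s, Fwd s] []"
    by (rule refinesI_lifts[OF conjunct1[OF path]]) auto
  ultimately show ?case by simp
qed

text \<open>Lifting the identity along \<open>[Fwd f]\<close> gives \<open>f\<close>; the invariance of lifts compares this with the
  unique lift along \<open>[Fwd g]\<close>.\<close>

lemma path_eq_Fwd_equalized:
  assumes f: "f \<in> Hom A X Y" and g: "g \<in> Hom A X Y" and eq: "path_eq A S X Y [Fwd f] [Fwd g]"
  shows "\<exists>V t. t \<in> S \<inter> Hom A V X \<and> f \<cdot>\<^bsub>A\<^esub> t = g \<cdot>\<^bsub>A\<^esub> t"
proof -
  have X: "Id A X \<in> Hom A X X"
    using f category.Dom_Ob[OF A] category.Id_Hom[OF A] by (auto simp: Hom_def)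
  have "lifts A (Id A X) [Fwd f] f" using category.Comp_Id[OF A f] by simp
  then obtain V t where t: "t \<in> S \<inter> Hom A V X" "f \<cdot>\<^bsub>A\<^esub> t = g \<cdot>\<^bsub>A\<^esub> (Id A X \<cdot>\<^bsub>A\<^esub> t)"
    using path_eq_refines[OF eq] X unfolding refines_def by fastforce
  moreover have "Id A X \<cdot>\<^bsub>A\<^esub> t = t" using t(1) category.Id_Comp[OF A] by blast
  ultimately show ?thesis by auto
qed

lemma lifts_exists:
  "path A S X p Y \<Longrightarrow> w \<in> Hom A W X \<Longrightarrow> \<exists>V t f. t \<in> S \<inter> Hom A V W \<and> lifts A (w \<cdot>\<^bsub>A\<^esub> t) p f"
proof (induction p arbitrary: w W X)
  case Nil
  then have "W \<in> Ob A" using category.Dom_Ob[OF A] by (auto simp: Hom_def)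
  then show ?case using right_calculus_Id by auto
next
  case (Cons e p)
  show ?case
  proof (cases e)
    case (Fwd g)
    with Cons.prems have g: "g \<in> Hom A X (Cod A g)" and p: "path A S (Cod A g) p Y"
      by (auto simp: Hom_def)
    obtain V t f where t: "t \<in> S \<inter> Hom A V W" "lifts A (g \<cdot>\<^bsub>A\<^esub> w \<cdot>\<^bsub>A\<^esub> t) p f"
      using Cons.IH[OF p category.Comp_Hom[OF A Cons.prems(2) g]] by blast
    have "g \<cdot>\<^bsub>A\<^esub> (w \<cdot>\<^bsub>A\<^esub> t) = g \<cdot>\<^bsub>A\<^esub> w \<cdot>\<^bsub>A\<^esub> t"
      using category.Comp_assoc[OF A _ Cons.prems(2) g] t(1) by blast
    with t have "lifts A (w \<cdot>\<^bsub>A\<^esub> t) (Fwd g # p) f" by simp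
    with t(1) show ?thesis unfolding Fwd by blast
  next
    case (Bwd s)
    with Cons.prems S have s: "s \<in> S \<inter> Hom A (Dom A s) X" and p: "path A S (Dom A s) p Y"
      by (auto simp: Hom_def)
    obtain V t v where t: "t \<in> S \<inter> Hom A V W" and v: "v \<in> Hom A V (Dom A s)" "s \<cdot>\<^bsub>A\<^esub> v = w \<cdot>\<^bsub>A\<^esub> t"
      using right_calculus_ore[OF R Cons.prems(2) s] by blast
    obtain V' t' f where t': "t' \<in> S \<inter> Hom A V' V" "lifts A (v \<cdot>\<^bsub>A\<^esub> t') p f"
      using Cons.IH[OF p v(1)] by blast
    have vt: "v \<cdot>\<^bsub>A\<^esub> t' \<in> Hom A V' (Dom A s)" using t' category.Comp_Hom[OF A _ v(1)] by blast
    have tt: "t \<cdot>\<^bsub>A\<^esub> t' \<in> S \<inter> Hom A V' W" by (rule right_calculus_Comp[OF t'(1) t])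
    have "w \<cdot>\<^bsub>A\<^esub> (t \<cdot>\<^bsub>A\<^esub> t') = s \<cdot>\<^bsub>A\<^esub> (v \<cdot>\<^bsub>A\<^esub> t')"
      using category.Comp_assoc[OF A, of t' V' V t W w X]
        category.Comp_assoc[OF A, of t' V' V v "Dom A s" s X] t t' v s Cons.prems(2) by simp
    moreover have "Dom A (w \<cdot>\<^bsub>A\<^esub> (t \<cdot>\<^bsub>A\<^esub> t')) = V'"
      using category.Comp_Hom[OF A _ Cons.prems(2)] tt by (auto simp: Hom_def)
    ultimately have "lifts A (w \<cdot>\<^bsub>A\<^esub> (t \<cdot>\<^bsub>A\<^esub> t')) (Bwd s # p) f" using t'(2) vt by auto
    with tt show ?thesis unfolding Bwd by blast
  qed
qed

text \<open>After a first \<open>t\<close> lifts along \<open>p\<close>, a further precomposition makes it lift along \<open>q\<close> as well,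
  and the lift along \<open>p\<close> survives.\<close>

lemma common_denominator:
  assumes p: "path A S X p Y" and q: "path A S X q Y"
  obtains W s f g where "s \<in> S \<inter> Hom A W X" "f \<in> Hom A W Y" "g \<in> Hom A W Y"
    "path_eq A S W Y (Fwd s # p) [Fwd f]" "path_eq A S W Y (Fwd s # q) [Fwd g]"
proof -
  have X: "Id A X \<in> S \<inter> Hom A X X" using path_Ob[OF A S p] right_calculus_Id by blast
  obtain V t f where t: "t \<in> S \<inter> Hom A V X" "lifts A (Id A X \<cdot>\<^bsub>A\<^esub> t) p f"
    using lifts_exists[OF p] X by blast
  have f: "lifts A t p f" using t category.Id_Comp[OF A, of t V X] by auto
  obtain W t' g where t': "t' \<in> S \<inter> Hom A W V" "lifts A (t \<cdot>\<^bsub>A\<^esub> t') q g"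
    using lifts_exists[OF q] t(1) by blast
  have s: "t \<cdot>\<^bsub>A\<^esub> t' \<in> S \<inter> Hom A W X" by (rule right_calculus_Comp[OF t'(1) t(1)])
  have f': "lifts A (t \<cdot>\<^bsub>A\<^esub> t') p (f \<cdot>\<^bsub>A\<^esub> t')" using lifts_precomp[OF A S _ p _ f] t t' by blast
  show ?thesis
    by (rule that[of "t \<cdot>\<^bsub>A\<^esub> t'" W "f \<cdot>\<^bsub>A\<^esub> t'" g])
      (use s f' t'(2) lifts_Hom[OF A S p] lifts_Hom[OF A S q] path_eq_lifts[OF A S p]
        path_eq_lifts[OF A S q] in blast)+
qed

end

section \<open>Powers of a category\<close>

lemma power_cat_simps:
  "Ob (power_cat I A) = I \<rightarrow>\<^sub>E Ob A" "Mor (power_cat I A) = I \<rightarrow>\<^sub>E Mor A"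
  "Dom (power_cat I A) f = (\<lambda>i\<in>I. Dom A (f i))" "Cod (power_cat I A) f = (\<lambda>i\<in>I. Cod A (f i))"
  "Id (power_cat I A) X = (\<lambda>i\<in>I. Id A (X i))" "g \<cdot>\<^bsub>power_cat I A\<^esub> f = (\<lambda>i\<in>I. g i \<cdot>\<^bsub>A\<^esub> f i)"
  by (simp_all add: power_cat_def)

lemma restrict_eq_iff:
  "(\<lambda>i\<in>I. f i) = g \<longleftrightarrow> g \<in> extensional I \<and> (\<forall>i\<in>I. f i = g i)"
  by (auto simp: fun_eq_iff restrict_def extensional_def)

lemma Hom_power_cat:
  "f \<in> Hom (power_cat I A) X Y \<longleftrightarrow> f \<in> extensional I \<and> X \<in> extensional I \<and> Y \<in> extensional I \<and>
    (\<forall>i\<in>I. f i \<in> Hom A (X i) (Y i))"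
  by (auto simp: Hom_def power_cat_simps PiE_iff restrict_eq_iff)

lemma category_power_cat:
  assumes A: "category A"
  shows "category (power_cat I A)"
  unfolding category_def
proof (intro conjI allI impI)
  fix W X Y Z f g h
  assume "f \<in> Hom (power_cat I A) W X" "g \<in> Hom (power_cat I A) X Y" "h \<in> Hom (power_cat I A) Y Z"
  then show "h \<cdot>\<^bsub>power_cat I A\<^esub> (g \<cdot>\<^bsub>power_cat I A\<^esub> f) = h \<cdot>\<^bsub>power_cat I A\<^esub> g \<cdot>\<^bsub>power_cat I A\<^esub> f"
    by (auto simp: Hom_power_cat power_cat_simps restrict_eq_iff
        intro!: category.Comp_assoc[OF A, of _ "W i" "X i" _ "Y i" _ "Z i" for i])
qed (auto simp: Hom_power_cat power_cat_simps PiE_iff restrict_eq_iff category.Dom_Ob[OF A]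
    category.Cod_Ob[OF A] category.Id_Hom[OF A] category.Comp_Id[OF A] category.Id_Comp[OF A]
    intro: category.Comp_Hom[OF A])

lemma power_mors_subset: "S \<subseteq> Mor A \<Longrightarrow> power_mors I S \<subseteq> Mor (power_cat I A)"
  by (auto simp: power_mors_def power_cat_simps PiE_iff)

lemma marked_functor_component:
  "i \<in> I \<Longrightarrow> marked_functor (power_cat I A) (power_mors I S) A S (\<lambda>X. X i) (\<lambda>f. f i)"
  by (auto simp: marked_functor_def Hom_power_cat power_cat_simps power_mors_def)

lemma right_calculus_power:
  assumes A: "category A" and R: "right_calculus A S"
  shows "right_calculus (power_cat I A) (power_mors I S)"
  unfolding right_calculus_def
proof (intro conjI allI impI ballI)
  show "Id (power_cat I A) X \<in> power_mors I S" if "X \<in> Ob (power_cat I A)" for X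
    using that R by (auto simp: power_cat_simps power_mors_def right_calculus_def)
  show "t \<cdot>\<^bsub>power_cat I A\<^esub> s \<in> power_mors I S"
    if "s \<in> power_mors I S" "t \<in> power_mors I S" "Cod (power_cat I A) s = Dom (power_cat I A) t" for s t
  proof -
    have "Cod A (s i) = Dom A (t i)" if "i \<in> I" for i
      using fun_cong[OF \<open>Cod (power_cat I A) s = Dom (power_cat I A) t\<close>, of i] that
      by (simp add: power_cat_simps)
    then show ?thesis
      using that R by (auto simp: power_cat_simps power_mors_def PiE_iff right_calculus_def)
  qed
next
  fix X Y Y' f s
  assume "f \<in> Hom (power_cat I A) X Y \<and> s \<in> power_mors I S \<inter> Hom (power_cat I A) Y' Y"
  then have ext: "X \<in> extensional I" "Y' \<in> extensional I"
    and "\<forall>i\<in>I. f i \<in> Hom A (X i) (Y i) \<and> s i \<in> S \<inter> Hom A (Y' i) (Y i)"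
    by (auto simp: Hom_power_cat power_mors_def)
  then have "\<forall>i\<in>I. \<exists>X' t f'. t \<in> S \<inter> Hom A X' (X i) \<and> f' \<in> Hom A X' (Y' i) \<and>
      s i \<cdot>\<^bsub>A\<^esub> f' = f i \<cdot>\<^bsub>A\<^esub> t"
    by (meson right_calculus_ore[OF R])
  then obtain X' t f' where *: "\<forall>i\<in>I. t i \<in> S \<inter> Hom A (X' i) (X i) \<and> f' i \<in> Hom A (X' i) (Y' i) \<and>
      s i \<cdot>\<^bsub>A\<^esub> f' i = f i \<cdot>\<^bsub>A\<^esub> t i"
    by metis
  show "\<exists>X' t f'. t \<in> power_mors I S \<inter> Hom (power_cat I A) X' X \<and> f' \<in> Hom (power_cat I A) X' Y' \<and>
      s \<cdot>\<^bsub>power_cat I A\<^esub> f' = f \<cdot>\<^bsub>power_cat I A\<^esub> t"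
    by (rule exI[of _ "\<lambda>i\<in>I. X' i"], rule exI[of _ "\<lambda>i\<in>I. t i"], rule exI[of _ "\<lambda>i\<in>I. f' i"])
      (use * ext in \<open>auto simp: Hom_power_cat power_mors_def power_cat_simps restrict_eq_iff\<close>)
next
  fix X Y f g
  assume "f \<in> Hom (power_cat I A) X Y \<and> g \<in> Hom (power_cat I A) X Y \<and>
    (\<exists>Y'. \<exists>s\<in>power_mors I S \<inter> Hom (power_cat I A) Y Y'.
      s \<cdot>\<^bsub>power_cat I A\<^esub> f = s \<cdot>\<^bsub>power_cat I A\<^esub> g)"
  then obtain Y' s where fg: "f \<in> Hom (power_cat I A) X Y" "g \<in> Hom (power_cat I A) X Y"
    and s: "s \<in> power_mors I S \<inter> Hom (power_cat I A) Y Y'"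
    and eq: "s \<cdot>\<^bsub>power_cat I A\<^esub> f = s \<cdot>\<^bsub>power_cat I A\<^esub> g" by blast
  have "s i \<cdot>\<^bsub>A\<^esub> f i = s i \<cdot>\<^bsub>A\<^esub> g i" if "i \<in> I" for i
    using fun_cong[OF eq, of i] that by (simp add: power_cat_simps)
  then have "\<forall>i\<in>I. f i \<in> Hom A (X i) (Y i) \<and> g i \<in> Hom A (X i) (Y i) \<and>
      s i \<in> S \<inter> Hom A (Y i) (Y' i) \<and> s i \<cdot>\<^bsub>A\<^esub> f i = s i \<cdot>\<^bsub>A\<^esub> g i"
    using fg s by (auto simp: Hom_power_cat power_mors_def)
  then have "\<forall>i\<in>I. \<exists>X' t. t \<in> S \<inter> Hom A X' (X i) \<and> f i \<cdot>\<^bsub>A\<^esub> t = g i \<cdot>\<^bsub>A\<^esub> t"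
    by (meson right_calculus_cancel[OF R])
  then obtain X' t where *: "\<forall>i\<in>I. t i \<in> S \<inter> Hom A (X' i) (X i) \<and> f i \<cdot>\<^bsub>A\<^esub> t i = g i \<cdot>\<^bsub>A\<^esub> t i"
    by metis
  show "\<exists>X'. \<exists>t\<in>power_mors I S \<inter> Hom (power_cat I A) X' X.
      f \<cdot>\<^bsub>power_cat I A\<^esub> t = g \<cdot>\<^bsub>power_cat I A\<^esub> t"
    by (rule exI[of _ "\<lambda>i\<in>I. X' i"], rule bexI[of _ "\<lambda>i\<in>I. t i"])
      (use * fg in \<open>auto simp: Hom_power_cat power_mors_def power_cat_simps restrict_eq_iff\<close>)
qed

section \<open>Localizing componentwise\<close>

abbreviation component :: "'i \<Rightarrow> ('i \<Rightarrow> 'm) edge list \<Rightarrow> 'm edge list" where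
  "component i \<equiv> map_path (\<lambda>f. f i)"

text \<open>Fullness and faithfulness of the comparison functor, stated for representing paths: it is in this
  form that the property dualizes by reversing lists and is used for coproducts.\<close>

definition paths_componentwise :: "'i set \<Rightarrow> ('o, 'm) cat \<Rightarrow> 'm set \<Rightarrow> bool" where
  "paths_componentwise I A S \<longleftrightarrow> (\<forall>X \<in> I \<rightarrow>\<^sub>E Ob A. \<forall>Y \<in> I \<rightarrow>\<^sub>E Ob A.
    (\<forall>ps. (\<forall>i \<in> I. path A S (X i) (ps i) (Y i)) \<longrightarrow>
      (\<exists>p. path (power_cat I A) (power_mors I S) X p Y \<and>
        (\<forall>i \<in> I. path_eq A S (X i) (Y i) (component i p) (ps i)))) \<and>
    (\<forall>p q. path (power_cat I A) (power_mors I S) X p Y \<and>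
        path (power_cat I A) (power_mors I S) X q Y \<and>
        (\<forall>i \<in> I. path_eq A S (X i) (Y i) (component i p) (component i q)) \<longrightarrow>
      path_eq (power_cat I A) (power_mors I S) X Y p q))"

lemma paths_componentwiseD:
  assumes "paths_componentwise I A S" "X \<in> I \<rightarrow>\<^sub>E Ob A" "Y \<in> I \<rightarrow>\<^sub>E Ob A"
  shows "(\<And>i. i \<in> I \<Longrightarrow> path A S (X i) (ps i) (Y i)) \<Longrightarrow>
      \<exists>p. path (power_cat I A) (power_mors I S) X p Y \<and>
        (\<forall>i \<in> I. path_eq A S (X i) (Y i) (component i p) (ps i))"
    and "path (power_cat I A) (power_mors I S) X p Y \<Longrightarrow>
      path (power_cat I A) (power_mors I S) X q Y \<Longrightarrow>
      (\<And>i. i \<in> I \<Longrightarrow> path_eq A S (X i) (Y i) (component i p) (component i q)) \<Longrightarrow>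
      path_eq (power_cat I A) (power_mors I S) X Y p q"
  using assms unfolding paths_componentwise_def by simp_all

text \<open>Fullness: write every member of the family as a fraction and choose the fractions simultaneously;
  the length of the resulting path does not depend on the member.  Faithfulness: bring both paths
  over one denominator in the power category, equalize the numerators in each component, and collect
  the equalizing morphisms.\<close>

lemma paths_componentwise_right:
  fixes A :: "('o, 'm) cat" and I :: "'i set"
  assumes A: "category A" and S: "S \<subseteq> Mor A" and R: "right_calculus A S"
  shows "paths_componentwise I A S"
proof -
  let ?P = "power_cat I A" and ?T = "power_mors I S"
  note P = category_power_cat[OF A, of I] and T = power_mors_subset[OF S, of I]
  note RP = right_calculus_power[OF A R, of I]
  have ex: "\<exists>p. path ?P ?T X p Y \<and> (\<forall>i\<in>I. path_eq A S (X i) (Y i) (component i p) (ps i))"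
    if X: "X \<in> I \<rightarrow>\<^sub>E Ob A" and Y: "Y \<in> I \<rightarrow>\<^sub>E Ob A" and ps: "\<forall>i\<in>I. path A S (X i) (ps i) (Y i)" for X Y ps
  proof -
    have "\<forall>i\<in>I. \<exists>W s f. s \<in> S \<inter> Hom A W (X i) \<and> f \<in> Hom A W (Y i) \<and>
        path_eq A S W (Y i) (Fwd s # ps i) [Fwd f]"
    proof
      fix i assume "i \<in> I"
      with ps have p: "path A S (X i) (ps i) (Y i)" by blast
      show "\<exists>W s f. s \<in> S \<inter> Hom A W (X i) \<and> f \<in> Hom A W (Y i) \<and>
        path_eq A S W (Y i) (Fwd s # ps i) [Fwd f]"
        by (rule common_denominator[OF A S R p p]) blast
    qed
    then obtain W s f where *: "\<forall>i\<in>I. s i \<in> S \<inter> Hom A (W i) (X i) \<and> f i \<in> Hom A (W i) (Y i) \<and>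
        path_eq A S (W i) (Y i) (Fwd (s i) # ps i) [Fwd (f i)]"
      by metis
    define s' f' where "s' = (\<lambda>i\<in>I. s i)" and "f' = (\<lambda>i\<in>I. f i)"
    have s': "s' \<in> ?T" "s' \<in> Hom ?P (\<lambda>i\<in>I. W i) X" and f': "f' \<in> Hom ?P (\<lambda>i\<in>I. W i) Y"
      using * X Y by (auto simp: s'_def f'_def Hom_power_cat power_mors_def PiE_iff)
    have "path ?P ?T X ([Bwd s'] @ [Fwd f']) Y"
      by (rule path_append[OF P T path_Bwd[OF P s'] path_Fwd[OF P f']])
    moreover have "path_eq A S (X i) (Y i) (component i [Bwd s', Fwd f']) (ps i)" if i: "i \<in> I" for i
    proof -
      have s: "s i \<in> S" "s i \<in> Hom A (W i) (X i)" and f: "f i \<in> Hom A (W i) (Y i)"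
        and eq: "path_eq A S (W i) (Y i) (Fwd (s i) # ps i) [Fwd (f i)]"
        using * i by auto
      have "path_eq A S (X i) (Y i) (ps i) [Bwd (s i), Fwd (f i)]"
        using path_eq_Bwd_Cons_iff[OF A s _ path_Fwd[OF A f]] ps i eq by simp
      then show ?thesis using i by (simp add: s'_def f'_def path_eq.sym)
    qed
    ultimately show ?thesis unfolding append_Cons append_Nil by blast
  qed
  have eq: "path_eq ?P ?T X Y p q"
    if p: "path ?P ?T X p Y" and q: "path ?P ?T X q Y"
      and pq: "\<forall>i\<in>I. path_eq A S (X i) (Y i) (component i p) (component i q)" for X Y p q
  proof -
    obtain W s f g where s: "s \<in> ?T \<inter> Hom ?P W X" and f: "f \<in> Hom ?P W Y" and g: "g \<in> Hom ?P W Y"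
      and sp: "path_eq ?P ?T W Y (Fwd s # p) [Fwd f]" and sq: "path_eq ?P ?T W Y (Fwd s # q) [Fwd g]"
      by (rule common_denominator[OF P T RP p q])
    have "\<forall>i\<in>I. \<exists>V t. t \<in> S \<inter> Hom A V (W i) \<and> f i \<cdot>\<^bsub>A\<^esub> t = g i \<cdot>\<^bsub>A\<^esub> t"
    proof
      fix i assume i: "i \<in> I"
      note pr = path_eq_map_path[OF P T A S marked_functor_component[OF i]]
      have si: "s i \<in> Hom A (W i) (X i)" using s i by (auto simp: Hom_power_cat)
      have "path_eq A S (W i) (Y i) (Fwd (s i) # component i p) (Fwd (s i) # component i q)"
        using path_eq_prepend[OF _ path_Fwd[OF A si]] pq i by fastforce
      then have "path_eq A S (W i) (Y i) [Fwd (f i)] [Fwd (g i)]"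
        using pr[OF sp] pr[OF sq] by simp (blast intro: path_eq.sym path_eq.trans)
      then show "\<exists>V t. t \<in> S \<inter> Hom A V (W i) \<and> f i \<cdot>\<^bsub>A\<^esub> t = g i \<cdot>\<^bsub>A\<^esub> t"
        using path_eq_Fwd_equalized[OF A S R] f g i by (auto simp: Hom_power_cat)
    qed
    then obtain V t where *: "\<forall>i\<in>I. t i \<in> S \<inter> Hom A (V i) (W i) \<and> f i \<cdot>\<^bsub>A\<^esub> t i = g i \<cdot>\<^bsub>A\<^esub> t i"
      by metis
    define t' where "t' = (\<lambda>i\<in>I. t i)"
    have t': "t' \<in> ?T" "t' \<in> Hom ?P (\<lambda>i\<in>I. V i) W" and ft: "f \<cdot>\<^bsub>?P\<^esub> t' = g \<cdot>\<^bsub>?P\<^esub> t'"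
      using * f by (auto simp: t'_def Hom_power_cat power_mors_def power_cat_simps restrict_eq_iff)
    have "path_eq ?P ?T (\<lambda>i\<in>I. V i) Y [Fwd t', Fwd f] [Fwd t', Fwd g]"
      using path_eq.Fwd_Comp[OF t'(2) f] path_eq.Fwd_Comp[OF t'(2) g] unfolding ft
      by (blast intro: path_eq.sym path_eq.trans)
    then have "path_eq ?P ?T W Y [Fwd f] [Fwd g]"
      by (rule path_eq_cancel_Fwd[OF P t' path_Fwd[OF P f] path_Fwd[OF P g]])
    then have "path_eq ?P ?T W Y (Fwd s # p) (Fwd s # q)"
      using sp sq by (blast intro: path_eq.sym path_eq.trans)
    then show ?thesis using path_eq_cancel_Fwd[OF P _ _ p q] s by blast
  qed
  show ?thesis unfolding paths_componentwise_def using ex eq by blast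
qed

text \<open>Powers commute with passing to the opposite category, and components with reversal.\<close>

lemma paths_componentwise_opp:
  assumes A: "category A" and S: "S \<subseteq> Mor A" and L: "paths_componentwise I (opp A) S"
  shows "paths_componentwise I A S"
proof -
  let ?P = "power_cat I A" and ?T = "power_mors I S"
  note P = category_power_cat[OF A, of I] and T = power_mors_subset[OF S, of I]
  note A' = category_opp[OF A] and P' = category_opp[OF P]
  have S': "S \<subseteq> Mor (opp A)" and T': "?T \<subseteq> Mor (opp ?P)" using S T by simp_all
  note unrev = path_rev[OF A' S', simplified] path_eq_rev[OF A' S', simplified]
    path_rev[OF P' T', simplified] path_eq_rev[OF P' T', simplified]
  have ex: "\<exists>p. path ?P ?T X p Y \<and> (\<forall>i\<in>I. path_eq A S (X i) (Y i) (component i p) (ps i))"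
    if X: "X \<in> I \<rightarrow>\<^sub>E Ob A" and Y: "Y \<in> I \<rightarrow>\<^sub>E Ob A" and ps: "\<forall>i\<in>I. path A S (X i) (ps i) (Y i)" for X Y ps
  proof -
    have "path (opp A) S (Y i) (rev (ps i)) (X i)" if "i \<in> I" for i
      using ps path_rev[OF A S] that by blast
    with paths_componentwiseD(1)[OF L, of Y X "\<lambda>i. rev (ps i)"] X Y
    obtain p where p: "path (opp ?P) ?T Y p X"
        "\<forall>i\<in>I. path_eq (opp A) S (Y i) (X i) (component i p) (rev (ps i))"
      by (auto simp: power_cat_opp)
    have "path_eq A S (X i) (Y i) (component i (rev p)) (ps i)" if "i \<in> I" for i
      using unrev(2)[of "Y i" "X i" "component i p" "rev (ps i)"] p(2) that by (simp add: rev_map)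
    then show ?thesis using unrev(3)[OF p(1)] by blast
  qed
  have eq: "path_eq ?P ?T X Y p q"
    if X: "X \<in> I \<rightarrow>\<^sub>E Ob A" and Y: "Y \<in> I \<rightarrow>\<^sub>E Ob A" and p: "path ?P ?T X p Y" and q: "path ?P ?T X q Y"
      and pq: "\<forall>i\<in>I. path_eq A S (X i) (Y i) (component i p) (component i q)" for X Y p q
  proof -
    have "path_eq (opp A) S (Y i) (X i) (component i (rev p)) (component i (rev q))" if "i \<in> I" for i
      using pq path_eq_rev[OF A S] that by (fastforce simp: rev_map)
    then have "path_eq (opp ?P) ?T Y X (rev p) (rev q)"
      using paths_componentwiseD(2)[OF L, of Y X "rev p" "rev q"] X Y path_rev[OF P T p] path_rev[OF P T q]
      by (simp add: power_cat_opp)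
    then show ?thesis using unrev(4) by fastforce
  qed
  show ?thesis unfolding paths_componentwise_def using ex eq by blast
qed

section \<open>The canonical comparison\<close>

text \<open>The inverse has to be restricted to the objects and morphisms of \<open>B\<close>, functors being
  extensional.\<close>

lemma is_cat_isoI:
  assumes F: "is_functor A B F"
    and ob: "bij_betw (FOb F) (Ob A) (Ob B)" and mor: "bij_betw (FMor F) (Mor A) (Mor B)"
  shows "is_cat_iso A B F"
proof -
  have A: "category A" and B: "category B" using F by (auto simp: is_functor_def)
  define GO GM where "GO = inv_into (Ob A) (FOb F)" and "GM = inv_into (Mor A) (FMor F)"
  have GO: "GO Y \<in> Ob A" "FOb F (GO Y) = Y" if "Y \<in> Ob B" for Y
    using that ob unfolding GO_def
    by (auto simp: bij_betw_def f_inv_into_f inv_into_into)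
  have GM: "GM g \<in> Mor A" "FMor F (GM g) = g" if "g \<in> Mor B" for g
    using that mor unfolding GM_def
    by (auto simp: bij_betw_def f_inv_into_f inv_into_into)
  have GO_F: "GO (FOb F X) = X" if "X \<in> Ob A" for X
    using that ob unfolding GO_def bij_betw_def by simp
  have GM_F: "GM (FMor F f) = f" if "f \<in> Mor A" for f
    using that mor unfolding GM_def bij_betw_def by simp
  have F_Dom: "Dom B (FMor F f) = FOb F (Dom A f)" "Cod B (FMor F f) = FOb F (Cod A f)"
    if "f \<in> Mor A" for f using F that by (auto simp: is_functor_def)
  have G_Dom: "Dom A (GM g) = GO (Dom B g)" "Cod A (GM g) = GO (Cod B g)" if g: "g \<in> Mor B" for g
    using F_Dom[OF GM(1)[OF g]] GO_F category.Dom_Ob[OF A GM(1)[OF g]]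
      category.Cod_Ob[OF A GM(1)[OF g]] by (auto simp: GM(2)[OF g])
  define G where "G = \<lparr>FOb = restrict GO (Ob B), FMor = restrict GM (Mor B)\<rparr>"
  have "is_functor B A G"
    unfolding is_functor_def
  proof (intro conjI ballI impI)
    show "category A" "category B" by fact+
    show "FOb G \<in> Ob B \<rightarrow>\<^sub>E Ob A" "FMor G \<in> Mor B \<rightarrow>\<^sub>E Mor A" using GO GM by (auto simp: G_def)
    show "Dom A (FMor G f) = FOb G (Dom B f)" "Cod A (FMor G f) = FOb G (Cod B f)"
      if "f \<in> Mor B" for f
      using that G_Dom category.Dom_Ob[OF B] category.Cod_Ob[OF B] by (auto simp: G_def)
    show "FMor G (Id B Y) = Id A (FOb G Y)" if Y: "Y \<in> Ob B" for Y
    proof -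
      have "Id A (GO Y) \<in> Mor A" "Id B Y \<in> Mor B"
        using category.Id_Hom[OF A GO(1)[OF Y]] category.Id_Hom[OF B Y] by (auto simp: Hom_def)
      moreover have "FMor F (Id A (GO Y)) = Id B Y"
        using F GO[OF Y] by (auto simp: is_functor_def)
      ultimately show ?thesis using GM_F Y by (force simp: G_def)
    qed
    show "FMor G (g \<cdot>\<^bsub>B\<^esub> f) = FMor G g \<cdot>\<^bsub>A\<^esub> FMor G f"
      if f: "f \<in> Mor B" and g: "g \<in> Mor B" and fg: "Cod B f = Dom B g" for f g
    proof -
      have "Cod A (GM f) = Dom A (GM g)" using G_Dom f g fg by simp
      then have m: "GM f \<in> Hom A (Dom A (GM f)) (Cod A (GM f))"
          "GM g \<in> Hom A (Cod A (GM f)) (Cod A (GM g))"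
        using GM f g by (auto simp: Hom_def)
      have "FMor F (GM g \<cdot>\<^bsub>A\<^esub> GM f) = g \<cdot>\<^bsub>B\<^esub> f" using is_functor_Comp[OF F m] GM f g by simp
      moreover have "GM g \<cdot>\<^bsub>A\<^esub> GM f \<in> Mor A" using category.Comp_Hom[OF A m] by (simp add: Hom_def)
      moreover have "g \<cdot>\<^bsub>B\<^esub> f \<in> Mor B"
        using category.Comp_Hom[OF B, of f "Dom B f" "Cod B f" g "Cod B g"] f g fg
        by (simp add: Hom_def)
      ultimately show ?thesis using GM_F f g by (force simp: G_def)
    qed
  qed
  moreover have "FOb F X \<in> Ob B" if "X \<in> Ob A" for X using F that by (auto simp: is_functor_def)
  moreover have "FMor F f \<in> Mor B" if "f \<in> Mor A" for f using F that by (auto simp: is_functor_def)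
  ultimately show ?thesis
    unfolding is_cat_iso_def using F GO GM GO_F GM_F
    by (intro conjI exI[of _ G]) (auto simp: comp_fctr_def id_fctr_def G_def compose_def fun_eq_iff)
qed

lemma is_functor_power_fctr:
  assumes F: "is_functor A B F"
  shows "is_functor (power_cat I A) (power_cat I B) (power_fctr I A F)"
proof -
  have A: "category A" and B: "category B" using F by (auto simp: is_functor_def)
  have FO: "FOb F X \<in> Ob B" "FMor F (Id A X) = Id B (FOb F X)" if "X \<in> Ob A" for X
    using F that by (auto simp: is_functor_def)
  have FM: "FMor F f \<in> Mor B" "Dom B (FMor F f) = FOb F (Dom A f)" "Cod B (FMor F f) = FOb F (Cod A f)"
    if "f \<in> Mor A" for f using F that by (auto simp: is_functor_def)
  show ?thesis
    unfolding is_functor_def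
  proof (intro conjI ballI impI)
    show "category (power_cat I A)" "category (power_cat I B)" by (rule category_power_cat[OF A], rule category_power_cat[OF B])
    show "FMor (power_fctr I A F) (g \<cdot>\<^bsub>power_cat I A\<^esub> f) =
        FMor (power_fctr I A F) g \<cdot>\<^bsub>power_cat I B\<^esub> FMor (power_fctr I A F) f"
      if fg: "f \<in> Mor (power_cat I A)" "g \<in> Mor (power_cat I A)"
        "Cod (power_cat I A) f = Dom (power_cat I A) g" for f g
    proof -
      have c: "f i \<in> Hom A (Dom A (f i)) (Cod A (f i))" "g i \<in> Hom A (Cod A (f i)) (Cod A (g i))"
        if "i \<in> I" for i
        using fun_cong[OF fg(3), of i] fg(1,2) that by (auto simp: power_cat_simps Hom_def)
      have "g i \<cdot>\<^bsub>A\<^esub> f i \<in> Mor A" "FMor F (g i \<cdot>\<^bsub>A\<^esub> f i) = FMor F (g i) \<cdot>\<^bsub>B\<^esub> FMor F (f i)"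
        if "i \<in> I" for i
        using category.Comp_Hom[OF A c[OF that]] is_functor_Comp[OF F c[OF that]]
        by (auto simp: Hom_def)
      then show ?thesis using fg(1,2)
        by (auto simp: power_fctr_def power_cat_simps restrict_eq_iff)
    qed
  qed (use FO FM category.Dom_Ob[OF A] category.Cod_Ob[OF A] category.Id_Hom[OF A] in
      \<open>auto simp: power_fctr_def power_cat_simps restrict_eq_iff PiE_iff Hom_def\<close>)
qed

lemma is_iso_power_cat:
  assumes f: "f \<in> extensional I" and iso: "\<And>i. i \<in> I \<Longrightarrow> is_iso A (f i)"
  shows "is_iso (power_cat I A) f"
proof -
  have "\<forall>i\<in>I. \<exists>g. g \<in> Hom A (Cod A (f i)) (Dom A (f i)) \<and>
      g \<cdot>\<^bsub>A\<^esub> f i = Id A (Dom A (f i)) \<and> f i \<cdot>\<^bsub>A\<^esub> g = Id A (Cod A (f i))"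
    using iso unfolding is_iso_def by blast
  then obtain g where g: "\<forall>i\<in>I. g i \<in> Hom A (Cod A (f i)) (Dom A (f i)) \<and>
      g i \<cdot>\<^bsub>A\<^esub> f i = Id A (Dom A (f i)) \<and> f i \<cdot>\<^bsub>A\<^esub> g i = Id A (Cod A (f i))"
    by metis
  show ?thesis unfolding is_iso_def
    by (intro conjI bexI[of _ "\<lambda>i\<in>I. g i"])
      (use f g iso in \<open>auto simp: power_cat_simps Hom_power_cat PiE_iff is_iso_def restrict_eq_iff\<close>)
qed

text \<open>Taking components of a path respects path classes; the union over all representatives avoids
  choosing one, as in the composition of \<open>loc\<close>.\<close>

definition comparison :: "'i set \<Rightarrow> ('o, 'm) cat \<Rightarrow> 'm set \<Rightarrow>
    ('i \<Rightarrow> 'o, ('i \<Rightarrow> 'o, 'i \<Rightarrow> 'm) loc_mor, 'i \<Rightarrow> 'o, 'i \<Rightarrow> ('o, 'm) loc_mor) fctr" where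
  "comparison I A S = \<lparr>FOb = (\<lambda>X \<in> I \<rightarrow>\<^sub>E Ob A. X),
    FMor = (\<lambda>m \<in> Mor (loc (power_cat I A) (power_mors I S)). \<lambda>i \<in> I. case m of (X, Y, P) \<Rightarrow>
      (X i, Y i, {q. \<exists>p \<in> P. path_eq A S (X i) (Y i) (component i p) q}))\<rparr>"

context
  fixes I :: "'i set" and A :: "('o, 'm) cat" and S
  assumes A: "category A" and S: "S \<subseteq> Mor A"
begin

lemma comparison_class:
  assumes p: "path (power_cat I A) (power_mors I S) X p Y"
  shows "FMor (comparison I A S) (path_class (power_cat I A) (power_mors I S) X Y p) =
    (\<lambda>i\<in>I. path_class A S (X i) (Y i) (component i p))"
proof -
  note P = category_power_cat[OF A, of I] and T = power_mors_subset[OF S, of I]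
  have "(\<exists>p'. path_eq (power_cat I A) (power_mors I S) X Y p p' \<and>
      path_eq A S (X i) (Y i) (component i p') q) \<longleftrightarrow> path_eq A S (X i) (Y i) (component i p) q"
    if "i \<in> I" for i q
    using path_eq_map_path[OF P T A S marked_functor_component[OF that]] p
    by (blast intro: path_eq.refl path_eq.trans)
  moreover have "path_class (power_cat I A) (power_mors I S) X Y p \<in>
      Mor (loc (power_cat I A) (power_mors I S))"
    using loc_HomI[OF p] by (simp add: Hom_def)
  ultimately show ?thesis by (auto simp: comparison_def path_class_def fun_eq_iff)
qed

lemma comparison_canonical: "is_canonical_comparison I A S (comparison I A S)"
proof -
  let ?P = "power_cat I A" and ?T = "power_mors I S"
  let ?L = "loc ?P ?T" and ?M = "power_cat I (loc A S)"
  note P = category_power_cat[OF A, of I] and T = power_mors_subset[OF S, of I]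
  note L = category_loc[OF P T] and M = category_power_cat[OF category_loc[OF A S], of I]
  note comp = path_map_path[OF P T A S marked_functor_component]
  have MorE: "\<exists>X Y p. path ?P ?T X p Y \<and> X \<in> I \<rightarrow>\<^sub>E Ob A \<and> Y \<in> I \<rightarrow>\<^sub>E Ob A \<and>
      m = path_class ?P ?T X Y p" if "m \<in> Mor ?L" for m
    using that path_Ob[OF P T] unfolding loc_def power_cat_simps by simp blast
  have Hom: "FMor (comparison I A S) (path_class ?P ?T X Y p) \<in> Hom ?M X Y"
    if p: "path ?P ?T X p Y" for X Y p
    using loc_HomI[OF comp[OF _ p]] path_Ob[OF P T p]
    by (auto simp: comparison_class[OF p] Hom_power_cat power_cat_simps PiE_iff)
  have F: "is_functor ?L ?M (comparison I A S)"
    unfolding is_functor_def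
  proof (intro conjI ballI impI)
    show "FOb (comparison I A S) \<in> Ob ?L \<rightarrow>\<^sub>E Ob ?M"
      by (auto simp: comparison_def loc_simps power_cat_simps)
    show "FMor (comparison I A S) \<in> Mor ?L \<rightarrow>\<^sub>E Mor ?M"
    proof (rule PiE_I)
      show "FMor (comparison I A S) m \<in> Mor ?M" if "m \<in> Mor ?L" for m
        using MorE[OF that] Hom by (auto simp: Hom_def)
    qed (simp add: comparison_def)
    show "Dom ?M (FMor (comparison I A S) m) = FOb (comparison I A S) (Dom ?L m)"
      "Cod ?M (FMor (comparison I A S) m) = FOb (comparison I A S) (Cod ?L m)" if m: "m \<in> Mor ?L" for m
    proof -
      obtain X Y p where p: "path ?P ?T X p Y" "X \<in> I \<rightarrow>\<^sub>E Ob A" "Y \<in> I \<rightarrow>\<^sub>E Ob A"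
        "m = path_class ?P ?T X Y p" using MorE[OF m] by blast
      have "FOb (comparison I A S) X = X" "FOb (comparison I A S) Y = Y"
        using p by (simp_all add: comparison_def)
      then show "Dom ?M (FMor (comparison I A S) m) = FOb (comparison I A S) (Dom ?L m)"
        "Cod ?M (FMor (comparison I A S) m) = FOb (comparison I A S) (Cod ?L m)"
        using Hom[OF p(1)] unfolding p(4) by (simp_all add: loc_simps Hom_def)
    qed
    show "FMor (comparison I A S) (Id ?L X) = Id ?M (FOb (comparison I A S) X)" if "X \<in> Ob ?L" for X
    proof -
      have X: "X \<in> I \<rightarrow>\<^sub>E Ob A" using that by (simp add: loc_simps power_cat_simps)
      then have "path ?P ?T X [] X" by (simp add: power_cat_simps)
      from comparison_class[OF this] X show ?thesis
        by (simp add: loc_simps power_cat_simps) (simp add: comparison_def loc_simps cong: restrict_cong)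
    qed
    show "FMor (comparison I A S) (n \<cdot>\<^bsub>?L\<^esub> m) =
        FMor (comparison I A S) n \<cdot>\<^bsub>?M\<^esub> FMor (comparison I A S) m"
      if m: "m \<in> Mor ?L" and n: "n \<in> Mor ?L" and mn: "Cod ?L m = Dom ?L n" for m n
    proof -
      obtain X Y p where p: "path ?P ?T X p Y" "m = path_class ?P ?T X Y p" using MorE[OF m] by blast
      obtain Y' Z q where "path ?P ?T Y' q Z" "n = path_class ?P ?T Y' Z q" using MorE[OF n] by blast
      moreover from this p mn have "Y' = Y" by (simp add: loc_simps)
      ultimately have q: "path ?P ?T Y q Z" "n = path_class ?P ?T Y Z q" by simp_all
      note pq = path_append[OF P T p(1) q(1)]
      show ?thesis
        unfolding p(2) q(2) loc_Comp_class[OF p(1) q(1)] comparison_class[OF p(1)]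
          comparison_class[OF q(1)] comparison_class[OF pq]
        using loc_Comp_class[OF comp[OF _ p(1)] comp[OF _ q(1)]]
        by (auto simp: power_cat_simps restrict_eq_iff)
    qed
  qed (fact L M)+
  have "FMor (comparison I A S) (FMor (loc_fctr ?P ?T) f) = (\<lambda>i\<in>I. FMor (loc_fctr A S) (f i))"
    if f: "f \<in> Mor ?P" for f
  proof -
    have fH: "f \<in> Hom ?P (Dom ?P f) (Cod ?P f)" using f by (simp add: Hom_def)
    show ?thesis
      unfolding loc_fctr_Hom[OF fH] comparison_class[OF path_Fwd[OF P fH]]
      using f by (auto simp: restrict_eq_iff loc_fctr_def power_cat_simps PiE_iff)
  qed
  then have "compose (Mor ?P) (FMor (comparison I A S)) (FMor (loc_fctr ?P ?T)) =
      FMor (power_fctr I A (loc_fctr A S))"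
    by (intro extensionalityI[where A = "Mor ?P"])
      (auto simp: compose_eq power_fctr_def power_cat_simps(2))
  moreover have "compose (Ob ?P) (FOb (comparison I A S)) (FOb (loc_fctr ?P ?T)) =
      FOb (power_fctr I A (loc_fctr A S))"
  proof (rule extensionalityI[OF compose_extensional])
    fix X assume "X \<in> Ob ?P"
    then have X: "X \<in> I \<rightarrow>\<^sub>E Ob A" by (simp add: power_cat_simps)
    then have "(\<lambda>i\<in>I. FOb (loc_fctr A S) (X i)) = X"
      by (auto simp: restrict_eq_iff loc_fctr_def PiE_iff)
    with X show "compose (Ob ?P) (FOb (comparison I A S)) (FOb (loc_fctr ?P ?T)) X =
        FOb (power_fctr I A (loc_fctr A S)) X"
      by (simp add: compose_eq power_fctr_def power_cat_simps(1) loc_fctr_def comparison_def)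
  qed (simp add: power_fctr_def power_cat_simps(1))
  ultimately have "comp_fctr ?P (comparison I A S) (loc_fctr ?P ?T) = power_fctr I A (loc_fctr A S)"
    by (simp add: comp_fctr_def)
  with F show ?thesis by (simp add: is_canonical_comparison_def)
qed

lemma ex1_canonical_comparison: "\<exists>!\<Theta>. is_canonical_comparison I A S \<Theta>"
proof -
  let ?Q = "power_fctr I A (loc_fctr A S)"
  have "is_functor (power_cat I A) (power_cat I (loc A S)) ?Q"
    by (rule is_functor_power_fctr[OF is_functor_loc_fctr[OF A S]])
  moreover have "is_iso (power_cat I (loc A S)) (FMor ?Q s)" if s: "s \<in> power_mors I S" for s
  proof -
    have "s \<in> I \<rightarrow>\<^sub>E Mor A" using s S by (auto simp: power_mors_def PiE_iff)
    with s show ?thesis using is_iso_loc_fctr[OF A S]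
      by (intro is_iso_power_cat) (auto simp: power_fctr_def power_mors_def)
  qed
  ultimately show ?thesis
    unfolding is_canonical_comparison_def
    by (rule loc_universal[OF category_power_cat[OF A] power_mors_subset[OF S]])
qed

lemma comparison_iso:
  assumes C: "paths_componentwise I A S"
  shows "is_cat_iso (loc (power_cat I A) (power_mors I S)) (power_cat I (loc A S)) (comparison I A S)"
proof (rule is_cat_isoI)
  let ?P = "power_cat I A" and ?T = "power_mors I S"
  let ?L = "loc ?P ?T" and ?M = "power_cat I (loc A S)"
  note P = category_power_cat[OF A, of I] and T = power_mors_subset[OF S, of I]
  show F: "is_functor ?L ?M (comparison I A S)"
    using comparison_canonical by (simp add: is_canonical_comparison_def)
  show "bij_betw (FOb (comparison I A S)) (Ob ?L) (Ob ?M)"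
    by (auto simp: bij_betw_def inj_on_def comparison_def loc_simps power_cat_simps)
  show "bij_betw (FMor (comparison I A S)) (Mor ?L) (Mor ?M)"
    unfolding bij_betw_def
  proof (intro conjI equalityI inj_onI subsetI)
    fix m n assume m: "m \<in> Mor ?L" and n: "n \<in> Mor ?L"
      and eq: "FMor (comparison I A S) m = FMor (comparison I A S) n"
    obtain X Y p where p: "path ?P ?T X p Y" "m = path_class ?P ?T X Y p"
      using m by (auto simp: loc_def)
    obtain X' Y' q where q: "path ?P ?T X' q Y'" "n = path_class ?P ?T X' Y' q"
      using n by (auto simp: loc_def)
    have ob: "X \<in> I \<rightarrow>\<^sub>E Ob A" "Y \<in> I \<rightarrow>\<^sub>E Ob A" "X' \<in> I \<rightarrow>\<^sub>E Ob A" "Y' \<in> I \<rightarrow>\<^sub>E Ob A"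
      using path_Ob[OF P T p(1)] path_Ob[OF P T q(1)] by (simp_all add: power_cat_simps)
    have cl: "path_class A S (X i) (Y i) (component i p) = path_class A S (X' i) (Y' i) (component i q)"
      if "i \<in> I" for i
      using fun_cong[OF eq, of i] that
      unfolding p(2) q(2) comparison_class[OF p(1)] comparison_class[OF q(1)] by simp
    have "X = X'"
      by (rule PiE_ext[OF ob(1,3)]) (use cl in \<open>simp add: path_class_def\<close>)
    have "Y = Y'"
      by (rule PiE_ext[OF ob(2,4)]) (use cl in \<open>simp add: path_class_def\<close>)
    note q' = q[folded \<open>X = X'\<close> \<open>Y = Y'\<close>]
    have "path_eq A S (X i) (Y i) (component i p) (component i q)" if i: "i \<in> I" for i
      using cl[OF i] path_eq.refl[OF path_map_path[OF P T A S marked_functor_component[OF i] q'(1)]]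
      unfolding \<open>X = X'\<close>[symmetric] \<open>Y = Y'\<close>[symmetric] by (auto simp: path_class_def)
    then have "path_eq ?P ?T X Y p q"
      by (rule paths_componentwiseD(2)[OF C ob(1,2) p(1) q'(1)])
    then show "m = n" unfolding p(2) q'(2) by (rule path_class_eqI)
  next
    fix m assume "m \<in> FMor (comparison I A S) ` Mor ?L"
    then show "m \<in> Mor ?M" using F by (auto simp: is_functor_def)
  next
    fix m assume m: "m \<in> Mor ?M"
    define X Y where "X = Dom ?M m" and "Y = Cod ?M m"
    have mH: "m \<in> Hom ?M X Y" using m by (simp add: Hom_def X_def Y_def)
    have ob: "X \<in> I \<rightarrow>\<^sub>E Ob A" "Y \<in> I \<rightarrow>\<^sub>E Ob A"
      using category.Dom_Ob[OF category_power_cat[OF category_loc[OF A S]] m]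
        category.Cod_Ob[OF category_power_cat[OF category_loc[OF A S]] m]
      by (simp_all add: X_def Y_def power_cat_simps loc_simps)
    have "\<forall>i\<in>I. \<exists>p. path A S (X i) p (Y i) \<and> m i = path_class A S (X i) (Y i) p"
      using mH by (auto simp: Hom_power_cat elim: loc_HomE)
    then obtain ps where ps: "\<forall>i\<in>I. path A S (X i) (ps i) (Y i) \<and> m i = path_class A S (X i) (Y i) (ps i)"
      by metis
    with paths_componentwiseD(1)[OF C ob, of ps]
    obtain p where p: "path ?P ?T X p Y" "\<forall>i\<in>I. path_eq A S (X i) (Y i) (component i p) (ps i)"
      by blast
    have "FMor (comparison I A S) (path_class ?P ?T X Y p) = m"
      unfolding comparison_class[OF p(1)]
      using p(2) ps mH path_class_eqI[of A S] by (fastforce simp: restrict_eq_iff Hom_power_cat)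
    moreover have "path_class ?P ?T X Y p \<in> Mor ?L" using loc_HomI[OF p(1)] by (simp add: Hom_def)
    ultimately show "m \<in> FMor (comparison I A S) ` Mor ?L" by blast
  qed
qed

lemma canonical_comparison_iso:
  assumes "paths_componentwise I A S" and "is_canonical_comparison I A S \<Theta>"
  shows "is_cat_iso (loc (power_cat I A) (power_mors I S)) (power_cat I (loc A S)) \<Theta>"
  using comparison_iso[OF assms(1)] comparison_canonical ex1_canonical_comparison assms(2) by blast

end

section \<open>Coproducts of paths\<close>

lemma marked_functor_id: "marked_functor A S A S (\<lambda>X. X) (\<lambda>f. f)"
  by (simp add: marked_functor_def)

lemma marked_functor_comp:
  assumes "marked_functor A S B T FO FM" "marked_functor B T C U GO GM"
  shows "marked_functor A S C U (\<lambda>X. GO (FO X)) (\<lambda>f. GM (FM f))"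
  using assms unfolding marked_functor_def by (intro conjI allI impI ballI) (simp | metis)+

text \<open>The morphism \<open>C \<rightarrow> D\<close> induced by a family \<open>X i \<rightarrow> D\<close> when \<open>C, j\<close> is a coproduct of \<open>X\<close>.\<close>

definition cotuple :: "'i set \<Rightarrow> ('o, 'm) cat \<Rightarrow> 'o \<Rightarrow> ('i \<Rightarrow> 'm) \<Rightarrow> 'o \<Rightarrow> ('i \<Rightarrow> 'm) \<Rightarrow> 'm" where
  "cotuple I A C j D f = (THE u. u \<in> Hom A C D \<and> (\<forall>i \<in> I. u \<cdot>\<^bsub>A\<^esub> j i = f i))"

lemma is_coproduct_ex1:
  "is_coproduct I A X C j \<Longrightarrow> D \<in> Ob A \<Longrightarrow> (\<And>i. i \<in> I \<Longrightarrow> f i \<in> Hom A (X i) D) \<Longrightarrow>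
    \<exists>!u. u \<in> Hom A C D \<and> (\<forall>i \<in> I. u \<cdot>\<^bsub>A\<^esub> j i = f i)"
  by (simp add: is_coproduct_def)

lemma cotuple:
  assumes "is_coproduct I A X C j" "D \<in> Ob A" "\<And>i. i \<in> I \<Longrightarrow> f i \<in> Hom A (X i) D"
  shows "cotuple I A C j D f \<in> Hom A C D" and "i \<in> I \<Longrightarrow> cotuple I A C j D f \<cdot>\<^bsub>A\<^esub> j i = f i"
proof -
  have "\<exists>!u. u \<in> Hom A C D \<and> (\<forall>i \<in> I. u \<cdot>\<^bsub>A\<^esub> j i = f i)"
    by (rule is_coproduct_ex1[OF assms])
  from theI'[OF this, folded cotuple_def]
  show "cotuple I A C j D f \<in> Hom A C D" and "i \<in> I \<Longrightarrow> cotuple I A C j D f \<cdot>\<^bsub>A\<^esub> j i = f i"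
    by blast+
qed

lemma coproduct_Hom_eqI:
  assumes A: "category A" and C: "is_coproduct I A X C j" and u: "u \<in> Hom A C D" and v: "v \<in> Hom A C D"
    and eq: "\<And>i. i \<in> I \<Longrightarrow> u \<cdot>\<^bsub>A\<^esub> j i = v \<cdot>\<^bsub>A\<^esub> j i"
  shows "u = v"
proof -
  have "D \<in> Ob A" using u category.Cod_Ob[OF A] by (auto simp: Hom_def)
  moreover have "v \<cdot>\<^bsub>A\<^esub> j i \<in> Hom A (X i) D" if "i \<in> I" for i
    using category.Comp_Hom[OF A _ v] C that unfolding is_coproduct_def by blast
  ultimately have "\<exists>!w. w \<in> Hom A C D \<and> (\<forall>i \<in> I. w \<cdot>\<^bsub>A\<^esub> j i = v \<cdot>\<^bsub>A\<^esub> j i)"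
    by (intro is_coproduct_ex1[OF C])
  then show ?thesis using u v eq by blast
qed

text \<open>The universal property in \<open>A[S\<^sup>-\<^sup>1]\<close> of a coproduct with injections coming from \<open>A\<close>, on
  representatives.  Applied to the opposite category it becomes, by reversal of paths, the universal
  property of a product (\<open>is_product_loc\<close>).\<close>

definition path_coproduct :: "'i set \<Rightarrow> ('o, 'm) cat \<Rightarrow> 'm set \<Rightarrow> ('i \<Rightarrow> 'o) \<Rightarrow> 'o \<Rightarrow> ('i \<Rightarrow> 'm) \<Rightarrow> bool" where
  "path_coproduct I A S X C j \<longleftrightarrow>
    (\<forall>D \<in> Ob A. \<forall>ps. (\<forall>i \<in> I. path A S (X i) (ps i) D) \<longrightarrow>
      (\<exists>u. path A S C u D \<and> (\<forall>i \<in> I. path_eq A S (X i) D (Fwd (j i) # u) (ps i)))) \<and>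
    (\<forall>D u v. path A S C u D \<and> path A S C v D \<and>
        (\<forall>i \<in> I. path_eq A S (X i) D (Fwd (j i) # u) (Fwd (j i) # v)) \<longrightarrow>
      path_eq A S C D u v)"

context
  fixes I :: "'i set" and A :: "('o, 'm) cat" and S and C and j
  assumes A: "category A" and S: "S \<subseteq> Mor A"
    and coprod: "\<And>X. X \<in> I \<rightarrow>\<^sub>E Ob A \<Longrightarrow> is_coproduct I A X (C X) (j X)"
    and closed: "\<And>X Y s u. X \<in> I \<rightarrow>\<^sub>E Ob A \<Longrightarrow> Y \<in> I \<rightarrow>\<^sub>E Ob A \<Longrightarrow>
      (\<And>i. i \<in> I \<Longrightarrow> s i \<in> S \<inter> Hom A (X i) (Y i)) \<Longrightarrow> u \<in> Hom A (C X) (C Y) \<Longrightarrow>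
      (\<And>i. i \<in> I \<Longrightarrow> u \<cdot>\<^bsub>A\<^esub> j X i = j Y i \<cdot>\<^bsub>A\<^esub> s i) \<Longrightarrow> u \<in> S"
begin

text \<open>The functor \<open>\<Coprod>\<close> on morphisms, for the chosen coproducts.\<close>

definition coprod_mor :: "('i \<Rightarrow> 'm) \<Rightarrow> 'm" where
  "coprod_mor f = (let X = Dom (power_cat I A) f; Y = Cod (power_cat I A) f in
    cotuple I A (C X) (j X) (C Y) (\<lambda>i. j Y i \<cdot>\<^bsub>A\<^esub> f i))"

definition diag :: "'a \<Rightarrow> 'i \<Rightarrow> 'a" where
  "diag D = (\<lambda>_ \<in> I. D)"

text \<open>The counit of the adjunction between \<open>\<Coprod>\<close> and the diagonal.\<close>

definition codiag :: "'o \<Rightarrow> 'm" where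
  "codiag D = cotuple I A (C (diag D)) (j (diag D)) D (\<lambda>_. Id A D)"

lemma Hom_power_Ob:
  "f \<in> Hom (power_cat I A) X Y \<Longrightarrow> X \<in> I \<rightarrow>\<^sub>E Ob A \<and> Y \<in> I \<rightarrow>\<^sub>E Ob A"
  using category.Dom_Ob[OF category_power_cat[OF A], of f I]
    category.Cod_Ob[OF category_power_cat[OF A], of f I]
  by (simp add: Hom_def) (simp add: power_cat_def)

lemma coproj_Hom: "X \<in> I \<rightarrow>\<^sub>E Ob A \<Longrightarrow> C X \<in> Ob A \<and> (\<forall>i\<in>I. j X i \<in> Hom A (X i) (C X))"
  using coprod by (simp add: is_coproduct_def)

lemma coprod_mor:
  assumes f: "f \<in> Hom (power_cat I A) X Y"
  shows "coprod_mor f \<in> Hom A (C X) (C Y)"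
    and "i \<in> I \<Longrightarrow> coprod_mor f \<cdot>\<^bsub>A\<^esub> j X i = j Y i \<cdot>\<^bsub>A\<^esub> f i"
proof -
  have X: "X \<in> I \<rightarrow>\<^sub>E Ob A" and Y: "Y \<in> I \<rightarrow>\<^sub>E Ob A" using Hom_power_Ob[OF f] by auto
  have "j Y i \<cdot>\<^bsub>A\<^esub> f i \<in> Hom A (X i) (C Y)" if "i \<in> I" for i
    using category.Comp_Hom[OF A, of "f i" "X i" "Y i"] coproj_Hom[OF Y] f that
    by (auto simp: Hom_power_cat)
  moreover have "coprod_mor f = cotuple I A (C X) (j X) (C Y) (\<lambda>i. j Y i \<cdot>\<^bsub>A\<^esub> f i)"
    using f by (simp add: coprod_mor_def Hom_def)
  ultimately show "coprod_mor f \<in> Hom A (C X) (C Y)"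
    and "i \<in> I \<Longrightarrow> coprod_mor f \<cdot>\<^bsub>A\<^esub> j X i = j Y i \<cdot>\<^bsub>A\<^esub> f i"
    using cotuple[OF coprod[OF X], of "C Y"] coproj_Hom[OF Y] by simp_all
qed

lemma marked_functor_coprod:
  "marked_functor (power_cat I A) (power_mors I S) A S C coprod_mor"
  unfolding marked_functor_def
proof (intro conjI ballI allI impI)
  note P = category_power_cat[OF A, of I]
  show "C X \<in> Ob A" if "X \<in> Ob (power_cat I A)" for X
    using that coproj_Hom by (simp add: power_cat_simps)
  show "coprod_mor (Id (power_cat I A) X) = Id A (C X)" if X: "X \<in> Ob (power_cat I A)" for X
  proof -
    have X': "X \<in> I \<rightarrow>\<^sub>E Ob A" using X by (simp add: power_cat_simps)
    note m = coprod_mor[OF category.Id_Hom[OF P X]]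
    show ?thesis
    proof (rule coproduct_Hom_eqI[OF A coprod[OF X'] m(1)])
      show "Id A (C X) \<in> Hom A (C X) (C X)" using coproj_Hom[OF X'] category.Id_Hom[OF A] by blast
      show "coprod_mor (Id (power_cat I A) X) \<cdot>\<^bsub>A\<^esub> j X i = Id A (C X) \<cdot>\<^bsub>A\<^esub> j X i" if i: "i \<in> I" for i
      proof -
        have ji: "j X i \<in> Hom A (X i) (C X)" using coproj_Hom[OF X'] i by blast
        show ?thesis using m(2)[OF i] i category.Comp_Id[OF A ji] category.Id_Comp[OF A ji]
          by (simp add: power_cat_simps)
      qed
    qed
  qed
  show "coprod_mor f \<in> Hom A (C X) (C Y)" if "f \<in> Hom (power_cat I A) X Y" for f X Y
    by (rule coprod_mor(1)[OF that])
  show "coprod_mor (g \<cdot>\<^bsub>power_cat I A\<^esub> f) = coprod_mor g \<cdot>\<^bsub>A\<^esub> coprod_mor f"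
    if f: "f \<in> Hom (power_cat I A) X Y" and g: "g \<in> Hom (power_cat I A) Y Z" for f g X Y Z
  proof (rule coproduct_Hom_eqI[OF A coprod])
    show X: "X \<in> I \<rightarrow>\<^sub>E Ob A" using Hom_power_Ob[OF f] by blast
    have Y: "Y \<in> I \<rightarrow>\<^sub>E Ob A" and Z: "Z \<in> I \<rightarrow>\<^sub>E Ob A" using Hom_power_Ob[OF g] by blast+
    note gf = category.Comp_Hom[OF P f g]
    note mf = coprod_mor[OF f] and mg = coprod_mor[OF g] and mgf = coprod_mor[OF gf]
    show "coprod_mor (g \<cdot>\<^bsub>power_cat I A\<^esub> f) \<in> Hom A (C X) (C Z)" by (rule mgf(1))
    show "coprod_mor g \<cdot>\<^bsub>A\<^esub> coprod_mor f \<in> Hom A (C X) (C Z)" by (rule category.Comp_Hom[OF A mf(1) mg(1)])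
    fix i assume i: "i \<in> I"
    have jX: "j X i \<in> Hom A (X i) (C X)" and jY: "j Y i \<in> Hom A (Y i) (C Y)"
      and jZ: "j Z i \<in> Hom A (Z i) (C Z)" using coproj_Hom X Y Z i by blast+
    have fi: "f i \<in> Hom A (X i) (Y i)" and gi: "g i \<in> Hom A (Y i) (Z i)"
      using f g i by (auto simp: Hom_power_cat)
    have "coprod_mor g \<cdot>\<^bsub>A\<^esub> coprod_mor f \<cdot>\<^bsub>A\<^esub> j X i = coprod_mor g \<cdot>\<^bsub>A\<^esub> (j Y i \<cdot>\<^bsub>A\<^esub> f i)"
      using category.Comp_assoc[OF A jX mf(1) mg(1)] mf(2)[OF i] by simp
    also have "\<dots> = j Z i \<cdot>\<^bsub>A\<^esub> g i \<cdot>\<^bsub>A\<^esub> f i"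
      using category.Comp_assoc[OF A fi jY mg(1)] mg(2)[OF i] by simp
    also have "\<dots> = coprod_mor (g \<cdot>\<^bsub>power_cat I A\<^esub> f) \<cdot>\<^bsub>A\<^esub> j X i"
      using category.Comp_assoc[OF A fi gi jZ] mgf(2)[OF i] i by (simp add: power_cat_simps)
    finally show "coprod_mor (g \<cdot>\<^bsub>power_cat I A\<^esub> f) \<cdot>\<^bsub>A\<^esub> j X i =
        coprod_mor g \<cdot>\<^bsub>A\<^esub> coprod_mor f \<cdot>\<^bsub>A\<^esub> j X i" by simp
  qed
  show "coprod_mor s \<in> S" if s: "s \<in> power_mors I S" for s
  proof -
    have "s \<in> Mor (power_cat I A)" using s power_mors_subset[OF S] by blast
    then obtain X Y where sH: "s \<in> Hom (power_cat I A) X Y" by (auto simp: Hom_def)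
    show ?thesis
      using closed[OF conjunct1[OF Hom_power_Ob[OF sH]] conjunct2[OF Hom_power_Ob[OF sH]],
          of s "coprod_mor s"] coprod_mor[OF sH] s sH
      by (auto simp: Hom_power_cat power_mors_def)
  qed
qed

lemma diag_Ob: "D \<in> Ob A \<Longrightarrow> diag D \<in> I \<rightarrow>\<^sub>E Ob A"
  by (simp add: diag_def)

lemma component_diag: "i \<in> I \<Longrightarrow> component i (map_path diag p) = p"
  by (simp add: edge.map_comp comp_def edge.map_ident diag_def)

lemma marked_functor_diag: "marked_functor A S (power_cat I A) (power_mors I S) diag diag"
  by (auto simp: marked_functor_def power_cat_simps Hom_power_cat diag_def power_mors_def restrict_eq_iff)

lemma codiag:
  assumes D: "D \<in> Ob A"
  shows "codiag D \<in> Hom A (C (diag D)) D" and "i \<in> I \<Longrightarrow> codiag D \<cdot>\<^bsub>A\<^esub> j (diag D) i = Id A D"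
  unfolding codiag_def
  using cotuple[OF coprod[OF diag_Ob[OF D]] D, of "\<lambda>_. Id A D"] category.Id_Hom[OF A D]
  by (simp_all add: diag_def)

lemma codiag_natural:
  assumes f: "f \<in> Hom A D E"
  shows "codiag E \<cdot>\<^bsub>A\<^esub> coprod_mor (diag f) = f \<cdot>\<^bsub>A\<^esub> codiag D"
proof -
  have D: "D \<in> Ob A" and E: "E \<in> Ob A"
    using f category.Dom_Ob[OF A] category.Cod_Ob[OF A] by (auto simp: Hom_def)
  have df: "diag f \<in> Hom (power_cat I A) (diag D) (diag E)"
    using marked_functor_diag f unfolding marked_functor_def by blast
  note m = coprod_mor[OF df]
  show ?thesis
  proof (rule coproduct_Hom_eqI[OF A coprod[OF diag_Ob[OF D]]])
    show "codiag E \<cdot>\<^bsub>A\<^esub> coprod_mor (diag f) \<in> Hom A (C (diag D)) E"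
      by (rule category.Comp_Hom[OF A m(1) codiag(1)[OF E]])
    show "f \<cdot>\<^bsub>A\<^esub> codiag D \<in> Hom A (C (diag D)) E"
      by (rule category.Comp_Hom[OF A codiag(1)[OF D] f])
    fix i assume i: "i \<in> I"
    have jD: "j (diag D) i \<in> Hom A D (C (diag D))" and jE: "j (diag E) i \<in> Hom A E (C (diag E))"
      using coproj_Hom[OF diag_Ob] D E i by (auto simp: diag_def)
    have "codiag E \<cdot>\<^bsub>A\<^esub> coprod_mor (diag f) \<cdot>\<^bsub>A\<^esub> j (diag D) i = codiag E \<cdot>\<^bsub>A\<^esub> (j (diag E) i \<cdot>\<^bsub>A\<^esub> f)"
      using category.Comp_assoc[OF A jD m(1) codiag(1)[OF E]] m(2)[OF i] i by (simp add: diag_def)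
    also have "\<dots> = f"
      using category.Comp_assoc[OF A f jE codiag(1)[OF E]] codiag(2)[OF E i] category.Id_Comp[OF A f] by simp
    also have "\<dots> = f \<cdot>\<^bsub>A\<^esub> codiag D \<cdot>\<^bsub>A\<^esub> j (diag D) i"
      using category.Comp_assoc[OF A jD codiag(1)[OF D] f] codiag(2)[OF D i] category.Comp_Id[OF A f] by simp
    finally show "codiag E \<cdot>\<^bsub>A\<^esub> coprod_mor (diag f) \<cdot>\<^bsub>A\<^esub> j (diag D) i =
        f \<cdot>\<^bsub>A\<^esub> codiag D \<cdot>\<^bsub>A\<^esub> j (diag D) i" .
  qed
qed

text \<open>Assemble the given paths into one path of the power category that ends in a diagonal object, apply
  \<open>\<Coprod>\<close> to it and fold with the codiagonal.  The injections being natural along paths, restricting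
  to the \<open>i\<close>-th summand gives back the \<open>i\<close>-th path.\<close>

lemma path_coproduct_cotuple:
  assumes L: "paths_componentwise I A S" and X: "X \<in> I \<rightarrow>\<^sub>E Ob A" and D: "D \<in> Ob A"
    and ps: "\<And>i. i \<in> I \<Longrightarrow> path A S (X i) (ps i) D"
  shows "\<exists>u. path A S (C X) u D \<and> (\<forall>i \<in> I. path_eq A S (X i) D (Fwd (j X i) # u) (ps i))"
proof -
  let ?P = "power_cat I A" and ?T = "power_mors I S"
  note P = category_power_cat[OF A, of I] and T = power_mors_subset[OF S, of I]
  obtain p where p: "path ?P ?T X p (diag D)"
    and comp: "\<forall>i \<in> I. path_eq A S (X i) D (component i p) (ps i)"
    using paths_componentwiseD(1)[OF L X diag_Ob[OF D], of ps] ps by (auto simp: diag_def)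
  let ?u = "map_path coprod_mor p"
  have u: "path A S (C X) ?u (C (diag D))" by (rule path_map_path[OF P T A S marked_functor_coprod p])
  note fold = path_Fwd[OF A codiag(1)[OF D]]
  have "path_eq A S (X i) D (Fwd (j X i) # ?u @ [Fwd (codiag D)]) (ps i)" if i: "i \<in> I" for i
  proof -
    have jD: "j (diag D) i \<in> Hom A D (C (diag D))"
      using coproj_Hom[OF diag_Ob[OF D]] i by (auto simp: diag_def)
    have "path_eq A S (X i) (C (diag D)) (component i p @ [Fwd (j (diag D) i)]) (Fwd (j X i) # ?u)"
      by (rule path_eq_natural[OF P T A S marked_functor_component[OF i] marked_functor_coprod _ _ p])
        (use coproj_Hom coprod_mor(2) i in \<open>auto simp: power_cat_simps\<close>)
    from path_eq_append[OF path_eq.sym[OF this] fold]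
    have "path_eq A S (X i) D (Fwd (j X i) # ?u @ [Fwd (codiag D)])
        (component i p @ [Fwd (j (diag D) i), Fwd (codiag D)])" by simp
    moreover have "path_eq A S D D [Fwd (j (diag D) i), Fwd (codiag D)] []"
      using path_eq.trans[OF path_eq.Fwd_Comp[OF jD codiag(1)[OF D]]] codiag(2)[OF D i]
        path_eq.Fwd_Id[OF D] by simp
    then have "path_eq A S (X i) D (component i p @ [Fwd (j (diag D) i), Fwd (codiag D)]) (ps i)"
      using path_eq.cong comp i by fastforce
    ultimately show ?thesis by (rule path_eq.trans)
  qed
  with path_append[OF A S u fold] show ?thesis by blast
qed

text \<open>A path \<open>w\<close> out of the coproduct is recovered from its adjoint transpose \<open>lift w\<close>, whose components
  are the restrictions of \<open>w\<close> to the summands: apply \<open>\<Coprod>\<close> and fold, using the triangle identity.  Equal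
  restrictions make the transposes equal because path classes in the power category are determined
  by their components.\<close>

lemma path_coproduct_unique:
  assumes L: "paths_componentwise I A S" and X: "X \<in> I \<rightarrow>\<^sub>E Ob A"
    and u: "path A S (C X) u D" and v: "path A S (C X) v D"
    and eq: "\<And>i. i \<in> I \<Longrightarrow> path_eq A S (X i) D (Fwd (j X i) # u) (Fwd (j X i) # v)"
  shows "path_eq A S (C X) D u v"
proof -
  let ?P = "power_cat I A" and ?T = "power_mors I S"
  note P = category_power_cat[OF A, of I] and T = power_mors_subset[OF S, of I]
  have CX: "C X \<in> Ob A" and D: "D \<in> Ob A" using path_Ob[OF A S u] by auto
  define \<iota> where "\<iota> = (\<lambda>i\<in>I. j X i)"
  have \<iota>: "\<iota> \<in> Hom ?P X (diag (C X))"
    using coproj_Hom[OF X] X by (auto simp: \<iota>_def Hom_power_cat diag_def PiE_iff)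
  define lift where "lift w = Fwd \<iota> # map_path diag w" for w
  have lift: "path ?P ?T X (lift w) (diag D)" if "path A S (C X) w D" for w
    using path_append[OF P T path_Fwd[OF P \<iota>] path_map_path[OF A S P T marked_functor_diag that]]
    by (simp add: lift_def)
  have lift_comp: "component i (lift w) = Fwd (j X i) # w" if "i \<in> I" for i w
    using that component_diag[OF that, of w] by (simp add: lift_def \<iota>_def del: map_map)
  have "path_eq ?P ?T X (diag D) (lift u) (lift v)"
    by (rule paths_componentwiseD(2)[OF L X diag_Ob[OF D] lift[OF u] lift[OF v]])
      (use eq D in \<open>simp add: lift_comp\<close>, simp add: diag_def)
  from path_eq_map_path[OF P T A S marked_functor_coprod this]
  have *: "path_eq A S (C X) (C (diag D)) (map_path coprod_mor (lift u)) (map_path coprod_mor (lift v))" .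
  note m = coprod_mor[OF \<iota>]
  have triangle: "codiag (C X) \<cdot>\<^bsub>A\<^esub> coprod_mor \<iota> = Id A (C X)"
  proof (rule coproduct_Hom_eqI[OF A coprod[OF X]])
    show "codiag (C X) \<cdot>\<^bsub>A\<^esub> coprod_mor \<iota> \<in> Hom A (C X) (C X)"
      by (rule category.Comp_Hom[OF A m(1) codiag(1)[OF CX]])
    show "Id A (C X) \<in> Hom A (C X) (C X)" by (rule category.Id_Hom[OF A CX])
    fix i assume i: "i \<in> I"
    have jX: "j X i \<in> Hom A (X i) (C X)" and jC: "j (diag (C X)) i \<in> Hom A (C X) (C (diag (C X)))"
      using coproj_Hom[OF X] coproj_Hom[OF diag_Ob[OF CX]] i by (auto simp: diag_def)
    show "codiag (C X) \<cdot>\<^bsub>A\<^esub> coprod_mor \<iota> \<cdot>\<^bsub>A\<^esub> j X i = Id A (C X) \<cdot>\<^bsub>A\<^esub> j X i"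
      using category.Comp_assoc[OF A jX m(1) codiag(1)[OF CX]] m(2)[OF i] i
        category.Comp_assoc[OF A jX jC codiag(1)[OF CX]] codiag(2)[OF CX i] by (simp add: \<iota>_def)
  qed
  have retract: "path_eq A S (C X) D (map_path coprod_mor (lift w) @ [Fwd (codiag D)]) w"
    if w: "path A S (C X) w D" for w
  proof -
    have "path_eq A S (C (diag (C X))) D
        (map_path (\<lambda>f. coprod_mor (diag f)) w @ [Fwd (codiag D)]) (Fwd (codiag (C X)) # map_path (\<lambda>f. f) w)"
      by (rule path_eq_natural[OF A S A S marked_functor_comp[OF marked_functor_diag marked_functor_coprod]
            marked_functor_id _ _ w]) (simp_all add: codiag(1) codiag_natural)
    moreover have "map_path (\<lambda>f. f) w = w" by (rule map_idI) (rule edge.map_ident)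
    ultimately have "path_eq A S (C (diag (C X))) D
        (map_path (\<lambda>f. coprod_mor (diag f)) w @ [Fwd (codiag D)]) (Fwd (codiag (C X)) # w)"
      by simp
    from path_eq_prepend[OF this path_Fwd[OF A m(1)]]
    have "path_eq A S (C X) D (map_path coprod_mor (lift w) @ [Fwd (codiag D)])
        ([Fwd (coprod_mor \<iota>), Fwd (codiag (C X))] @ w)"
      by (simp add: lift_def edge.map_comp comp_def)
    moreover have "path_eq A S (C X) (C X) [Fwd (coprod_mor \<iota>), Fwd (codiag (C X))] []"
      using path_eq.trans[OF path_eq.Fwd_Comp[OF m(1) codiag(1)[OF CX]]] triangle
        path_eq.Fwd_Id[OF CX] by simp
    from path_eq_append[OF this w]
    have "path_eq A S (C X) D ([Fwd (coprod_mor \<iota>), Fwd (codiag (C X))] @ w) w" by simp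
    ultimately show ?thesis by (rule path_eq.trans)
  qed
  show ?thesis
    using path_eq.trans[OF path_eq.sym[OF retract[OF u]]
        path_eq.trans[OF path_eq_append[OF * path_Fwd[OF A codiag(1)[OF D]]] retract[OF v]]] .
qed

end

lemma path_coproduct:
  assumes A: "category A" and S: "S \<subseteq> Mor A" and L: "paths_componentwise I A S"
    and closed: "closed_under_coproducts I A S" and X: "X \<in> I \<rightarrow>\<^sub>E Ob A"
  obtains C j where "is_coproduct I A X C j" "path_coproduct I A S X C j"
proof -
  obtain C j where cj: "\<forall>X \<in> I \<rightarrow>\<^sub>E Ob A. is_coproduct I A X (C X) (j X)"
      "\<forall>X \<in> I \<rightarrow>\<^sub>E Ob A. \<forall>Y \<in> I \<rightarrow>\<^sub>E Ob A. \<forall>s u.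
        (\<forall>i \<in> I. s i \<in> S \<inter> Hom A (X i) (Y i)) \<and>
        u \<in> Hom A (C X) (C Y) \<and> (\<forall>i \<in> I. u \<cdot>\<^bsub>A\<^esub> j X i = j Y i \<cdot>\<^bsub>A\<^esub> s i) \<longrightarrow> u \<in> S"
    using closed unfolding closed_under_coproducts_def by (elim exE conjE)
  have coprod: "is_coproduct I A X (C X) (j X)" if "X \<in> I \<rightarrow>\<^sub>E Ob A" for X
    using cj(1) that by blast
  have cl: "u \<in> S"
    if "X \<in> I \<rightarrow>\<^sub>E Ob A" "Y \<in> I \<rightarrow>\<^sub>E Ob A" "\<And>i. i \<in> I \<Longrightarrow> s i \<in> S \<inter> Hom A (X i) (Y i)"
      "u \<in> Hom A (C X) (C Y)" "\<And>i. i \<in> I \<Longrightarrow> u \<cdot>\<^bsub>A\<^esub> j X i = j Y i \<cdot>\<^bsub>A\<^esub> s i" for X Y s u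
    by (rule cj(2)[rule_format, of X Y s u]) (use that in simp_all)
  have "path_coproduct I A S X (C X) (j X)"
    unfolding path_coproduct_def
  proof (intro conjI ballI allI impI)
    fix D ps assume D: "D \<in> Ob A" and ps: "\<forall>i \<in> I. path A S (X i) (ps i) D"
    show "\<exists>u. path A S (C X) u D \<and> (\<forall>i \<in> I. path_eq A S (X i) D (Fwd (j X i) # u) (ps i))"
      by (rule path_coproduct_cotuple[of A S I C j, OF A S _ _ L X D])
        (fact coprod, fact cl, use ps in blast)
  next
    fix D u v
    assume uv: "path A S (C X) u D \<and> path A S (C X) v D \<and>
      (\<forall>i \<in> I. path_eq A S (X i) D (Fwd (j X i) # u) (Fwd (j X i) # v))"
    show "path_eq A S (C X) D u v"
      by (rule path_coproduct_unique[of A S I C j, OF A S _ _ L X])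
        (fact coprod, fact cl, use uv in blast, use uv in blast, use uv in blast)
  qed
  with coprod[OF X] show ?thesis by (rule that)
qed

section \<open>Coproducts and products in the localization\<close>

lemma path_class_eq_iff:
  assumes "path A S X q Y"
  shows "path_class A S X Y p = path_class A S X Y q \<longleftrightarrow> path_eq A S X Y p q"
proof
  assume "path_class A S X Y p = path_class A S X Y q"
  then have "{r. path_eq A S X Y p r} = {r. path_eq A S X Y q r}" by (simp add: path_class_def)
  then show "path_eq A S X Y p q" using path_eq.refl[OF assms] by blast
qed (rule path_class_eqI)

lemma is_coproduct_loc:
  assumes A: "category A" and S: "S \<subseteq> Mor A"
    and C: "is_coproduct I A X C j" and pc: "path_coproduct I A S X C j"
  shows "is_coproduct I (loc A S) X C (\<lambda>i. FMor (loc_fctr A S) (j i))"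
proof -
  have ob: "X \<in> I \<rightarrow> Ob A" "C \<in> Ob A" and j: "j i \<in> Hom A (X i) C" if "i \<in> I" for i
    using C that by (auto simp: is_coproduct_def)
  have comp: "path_class A S C D w \<cdot>\<^bsub>loc A S\<^esub> FMor (loc_fctr A S) (j i) =
      path_class A S (X i) D (Fwd (j i) # w)" if "i \<in> I" "path A S C w D" for i w D
    using loc_Comp_class[OF path_Fwd[OF A j[OF that(1)]] that(2)] by (simp add: loc_fctr_Hom[OF j[OF that(1)]])
  show ?thesis
    unfolding is_coproduct_def loc_simps
  proof (intro conjI ballI allI impI)
    show "X \<in> I \<rightarrow> Ob A" "C \<in> Ob A" using C by (auto simp: is_coproduct_def)
    show "FMor (loc_fctr A S) (j i) \<in> Hom (loc A S) (X i) C" if "i \<in> I" for i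
      using loc_HomI[OF path_Fwd[OF A j[OF that]]] by (simp add: loc_fctr_Hom[OF j[OF that]])
    fix D f assume "D \<in> Ob A \<and> (\<forall>i\<in>I. f i \<in> Hom (loc A S) (X i) D)"
    then have D: "D \<in> Ob A" and "\<forall>i\<in>I. \<exists>p. path A S (X i) p D \<and> f i = path_class A S (X i) D p"
      by (auto elim: loc_HomE)
    then obtain ps where ps: "\<forall>i\<in>I. path A S (X i) (ps i) D \<and> f i = path_class A S (X i) D (ps i)"
      by metis
    then have "\<forall>i\<in>I. path A S (X i) (ps i) D" by blast
    then have "\<exists>u. path A S C u D \<and> (\<forall>i\<in>I. path_eq A S (X i) D (Fwd (j i) # u) (ps i))"
      using conjunct1[OF pc[unfolded path_coproduct_def], rule_format, of D ps] D by simp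
    then obtain u where u: "path A S C u D"
        "\<forall>i\<in>I. path_eq A S (X i) D (Fwd (j i) # u) (ps i)" by blast
    show "\<exists>!m. m \<in> Hom (loc A S) C D \<and> (\<forall>i\<in>I. m \<cdot>\<^bsub>loc A S\<^esub> FMor (loc_fctr A S) (j i) = f i)"
    proof (rule ex1I[of _ "path_class A S C D u"])
      show "path_class A S C D u \<in> Hom (loc A S) C D \<and>
          (\<forall>i\<in>I. path_class A S C D u \<cdot>\<^bsub>loc A S\<^esub> FMor (loc_fctr A S) (j i) = f i)"
        using loc_HomI[OF u(1)] u ps by (simp add: comp path_class_eq_iff)
      fix m assume m: "m \<in> Hom (loc A S) C D \<and>
          (\<forall>i\<in>I. m \<cdot>\<^bsub>loc A S\<^esub> FMor (loc_fctr A S) (j i) = f i)"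
      then obtain v where v: "path A S C v D" "m = path_class A S C D v" by (auto elim: loc_HomE)
      have "path_eq A S (X i) D (Fwd (j i) # v) (Fwd (j i) # u)" if "i \<in> I" for i
      proof -
        have "path_eq A S (X i) D (Fwd (j i) # v) (ps i)"
          using m ps that by (simp add: v comp path_class_eq_iff)
        then show ?thesis using u(2) that by (blast intro: path_eq.sym path_eq.trans)
      qed
      then have "path_eq A S C D v u" using pc u(1) v(1) unfolding path_coproduct_def by blast
      then show "m = path_class A S C D u" unfolding v(2) by (rule path_class_eqI)
    qed
  qed
qed

text \<open>Path reversal turns the universal property for the opposite category into that of a product.\<close>

lemma is_product_loc:
  assumes A: "category A" and S: "S \<subseteq> Mor A"
    and C: "is_product I A X C j" and pc: "path_coproduct I (opp A) S X C j"
  shows "is_product I (loc A S) X C (\<lambda>i. FMor (loc_fctr A S) (j i))"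
proof -
  have S': "S \<subseteq> Mor (opp A)" using S by simp
  note to_opp = path_rev[OF A S] path_eq_rev[OF A S]
  note from_opp = path_rev[OF category_opp[OF A] S', simplified] path_eq_rev[OF category_opp[OF A] S', simplified]
  have j: "j i \<in> Hom A C (X i)" if "i \<in> I" for i
    using C that by (auto simp: is_product_def)
  have comp: "FMor (loc_fctr A S) (j i) \<cdot>\<^bsub>loc A S\<^esub> path_class A S D C w =
      path_class A S D (X i) (w @ [Fwd (j i)])" if "i \<in> I" "path A S D w C" for i w D
    using loc_Comp_class[OF that(2) path_Fwd[OF A j[OF that(1)]]] by (simp add: loc_fctr_Hom[OF j[OF that(1)]])
  show ?thesis
    unfolding is_product_def loc_simps
  proof (intro conjI ballI allI impI)
    show "X \<in> I \<rightarrow> Ob A" "C \<in> Ob A" using C by (auto simp: is_product_def)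
    show "FMor (loc_fctr A S) (j i) \<in> Hom (loc A S) C (X i)" if "i \<in> I" for i
      using loc_HomI[OF path_Fwd[OF A j[OF that]]] by (simp add: loc_fctr_Hom[OF j[OF that]])
    fix D f assume "D \<in> Ob A \<and> (\<forall>i\<in>I. f i \<in> Hom (loc A S) D (X i))"
    then have D: "D \<in> Ob A" and "\<forall>i\<in>I. \<exists>p. path A S D p (X i) \<and> f i = path_class A S D (X i) p"
      by (auto elim: loc_HomE)
    then obtain ps where ps: "\<forall>i\<in>I. path A S D (ps i) (X i) \<and> f i = path_class A S D (X i) (ps i)"
      by metis
    have ps': "\<forall>i\<in>I. path (opp A) S (X i) (rev (ps i)) D" using ps to_opp(1) by blast
    have "\<exists>u. path (opp A) S C u D \<and> (\<forall>i\<in>I. path_eq (opp A) S (X i) D (Fwd (j i) # u) (rev (ps i)))"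
      using conjunct1[OF pc[unfolded path_coproduct_def], rule_format, of D "\<lambda>i. rev (ps i)"] D ps' by simp
    then obtain u where u: "path (opp A) S C u D"
        "\<forall>i\<in>I. path_eq (opp A) S (X i) D (Fwd (j i) # u) (rev (ps i))"
      by blast
    have pu: "path A S D (rev u) C" by (rule from_opp(1)[OF u(1)])
    have eu: "path_eq A S D (X i) (rev u @ [Fwd (j i)]) (ps i)" if "i \<in> I" for i
      using from_opp(2)[of "X i" D "Fwd (j i) # u" "rev (ps i)"] u(2) that by simp
    show "\<exists>!m. m \<in> Hom (loc A S) D C \<and> (\<forall>i\<in>I. FMor (loc_fctr A S) (j i) \<cdot>\<^bsub>loc A S\<^esub> m = f i)"
    proof (rule ex1I[of _ "path_class A S D C (rev u)"])
      show "path_class A S D C (rev u) \<in> Hom (loc A S) D C \<and>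
          (\<forall>i\<in>I. FMor (loc_fctr A S) (j i) \<cdot>\<^bsub>loc A S\<^esub> path_class A S D C (rev u) = f i)"
        using loc_HomI[OF pu] pu eu ps by (simp add: comp path_class_eq_iff)
      fix m assume m: "m \<in> Hom (loc A S) D C \<and>
          (\<forall>i\<in>I. FMor (loc_fctr A S) (j i) \<cdot>\<^bsub>loc A S\<^esub> m = f i)"
      then obtain v where v: "path A S D v C" "m = path_class A S D C v" by (auto elim: loc_HomE)
      have "path_eq (opp A) S (X i) D (Fwd (j i) # rev v) (Fwd (j i) # u)" if "i \<in> I" for i
      proof -
        have "path_eq A S D (X i) (v @ [Fwd (j i)]) (ps i)"
          using m ps that by (simp add: v comp path_class_eq_iff)
        then have "path_eq A S D (X i) (v @ [Fwd (j i)]) (rev u @ [Fwd (j i)])"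
          using eu[OF that] by (blast intro: path_eq.sym path_eq.trans)
        from to_opp(2)[OF this] show ?thesis by simp
      qed
      then have "path_eq (opp A) S C D (rev v) u"
        using pc u(1) to_opp(1)[OF v(1)] unfolding path_coproduct_def by blast
      from from_opp(2)[OF this] have "path_eq A S D C v (rev u)" by simp
      then show "m = path_class A S D C (rev u)" unfolding v(2) by (rule path_class_eqI)
    qed
  qed
qed

lemma is_coproduct_cong:
  assumes "\<And>i. i \<in> I \<Longrightarrow> X i = X' i" "\<And>i. i \<in> I \<Longrightarrow> j i = j' i"
  shows "is_coproduct I A X C j \<longleftrightarrow> is_coproduct I A X' C j'"
  using assms by (simp add: is_coproduct_def Pi_iff cong: ball_cong)

text \<open>Coproducts of one family are isomorphic compatibly with their injections, and functors preserve
  isomorphisms.  It matters here because closure of \<open>S\<close> is available only for one choice of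
  coproducts, whereas preservation concerns all of them.\<close>

lemma preserves_coproductsI:
  assumes F: "is_functor A B F"
    and ex: "\<And>X. X \<in> I \<rightarrow>\<^sub>E Ob A \<Longrightarrow> \<exists>C j. is_coproduct I A X C j \<and>
      is_coproduct I B (\<lambda>i. FOb F (X i)) (FOb F C) (\<lambda>i. FMor F (j i))"
  shows "preserves_coproducts I A B F"
  unfolding preserves_coproducts_def
proof (intro allI impI)
  fix X C' j' assume C'0: "is_coproduct I A X C' j'"
  define Y where "Y = (\<lambda>i\<in>I. X i)"
  have C': "is_coproduct I A Y C' j'" using C'0 is_coproduct_cong[of I Y X j' j' A C'] by (simp add: Y_def)
  have "Y \<in> I \<rightarrow>\<^sub>E Ob A" using C'0 by (auto simp: Y_def is_coproduct_def)
  from ex[OF this] obtain C j where C: "is_coproduct I A Y C j"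
    and FC: "is_coproduct I B (\<lambda>i. FOb F (Y i)) (FOb F C) (\<lambda>i. FMor F (j i))" by blast
  have A: "category A" and B: "category B" using F by (auto simp: is_functor_def)
  have ob: "C \<in> Ob A" "C' \<in> Ob A" using C C' by (auto simp: is_coproduct_def)
  have j: "j i \<in> Hom A (Y i) C" and j': "j' i \<in> Hom A (Y i) C'" if "i \<in> I" for i
    using C C' that by (auto simp: is_coproduct_def)
  define v w where "v = cotuple I A C j C' j'" and "w = cotuple I A C' j' C j"
  have v: "v \<in> Hom A C C'" "\<And>i. i \<in> I \<Longrightarrow> v \<cdot>\<^bsub>A\<^esub> j i = j' i"
    using cotuple[OF C ob(2), of j'] j' by (auto simp: v_def)
  have w: "w \<in> Hom A C' C" "\<And>i. i \<in> I \<Longrightarrow> w \<cdot>\<^bsub>A\<^esub> j' i = j i"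
    using cotuple[OF C' ob(1), of j] j by (auto simp: w_def)
  have vw: "v \<cdot>\<^bsub>A\<^esub> w = Id A C'"
  proof (rule coproduct_Hom_eqI[OF A C' category.Comp_Hom[OF A w(1) v(1)] category.Id_Hom[OF A ob(2)]])
    fix i assume i: "i \<in> I"
    show "v \<cdot>\<^bsub>A\<^esub> w \<cdot>\<^bsub>A\<^esub> j' i = Id A C' \<cdot>\<^bsub>A\<^esub> j' i"
      using category.Comp_assoc[OF A j'[OF i] w(1) v(1)] v(2)[OF i] w(2)[OF i]
        category.Id_Comp[OF A j'[OF i]] by simp
  qed
  note FH = is_functor_Hom[OF F] and Fc = is_functor_Comp[OF F]
  have "is_coproduct I B (\<lambda>i. FOb F (Y i)) (FOb F C') (\<lambda>i. FMor F (j' i))"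
    unfolding is_coproduct_def
  proof (intro conjI ballI allI impI)
    show "(\<lambda>i. FOb F (Y i)) \<in> I \<rightarrow> Ob B" using FC by (simp add: is_coproduct_def)
    show "FOb F C' \<in> Ob B" using F ob by (auto simp: is_functor_def)
    show "FMor F (j' i) \<in> Hom B (FOb F (Y i)) (FOb F C')" if "i \<in> I" for i by (rule FH[OF j'[OF that]])
    fix D f assume Df: "D \<in> Ob B \<and> (\<forall>i\<in>I. f i \<in> Hom B (FOb F (Y i)) D)"
    define u where "u = cotuple I B (FOb F C) (\<lambda>i. FMor F (j i)) D f"
    have u: "u \<in> Hom B (FOb F C) D" "\<And>i. i \<in> I \<Longrightarrow> u \<cdot>\<^bsub>B\<^esub> FMor F (j i) = f i"
      using cotuple[OF FC conjunct1[OF Df], of f] Df by (auto simp: u_def)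
    show "\<exists>!m. m \<in> Hom B (FOb F C') D \<and> (\<forall>i\<in>I. m \<cdot>\<^bsub>B\<^esub> FMor F (j' i) = f i)"
    proof (rule ex1I[of _ "u \<cdot>\<^bsub>B\<^esub> FMor F w"])
      show "u \<cdot>\<^bsub>B\<^esub> FMor F w \<in> Hom B (FOb F C') D \<and> (\<forall>i\<in>I. u \<cdot>\<^bsub>B\<^esub> FMor F w \<cdot>\<^bsub>B\<^esub> FMor F (j' i) = f i)"
      proof (intro conjI ballI)
        show "u \<cdot>\<^bsub>B\<^esub> FMor F w \<in> Hom B (FOb F C') D" by (rule category.Comp_Hom[OF B FH[OF w(1)] u(1)])
        show "u \<cdot>\<^bsub>B\<^esub> FMor F w \<cdot>\<^bsub>B\<^esub> FMor F (j' i) = f i" if i: "i \<in> I" for i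
          unfolding category.Comp_assoc[OF B FH[OF j'[OF i]] FH[OF w(1)] u(1), symmetric]
            Fc[OF j'[OF i] w(1), symmetric] w(2)[OF i] by (rule u(2)[OF i])
      qed
      fix m assume m: "m \<in> Hom B (FOb F C') D \<and> (\<forall>i\<in>I. m \<cdot>\<^bsub>B\<^esub> FMor F (j' i) = f i)"
      then have mH: "m \<in> Hom B (FOb F C') D" by blast
      have "m \<cdot>\<^bsub>B\<^esub> FMor F v = u"
      proof (rule coproduct_Hom_eqI[OF B FC category.Comp_Hom[OF B FH[OF v(1)] mH] u(1)])
        fix i assume i: "i \<in> I"
        show "m \<cdot>\<^bsub>B\<^esub> FMor F v \<cdot>\<^bsub>B\<^esub> FMor F (j i) = u \<cdot>\<^bsub>B\<^esub> FMor F (j i)"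
          unfolding category.Comp_assoc[OF B FH[OF j[OF i]] FH[OF v(1)] mH, symmetric]
            Fc[OF j[OF i] v(1), symmetric] v(2)[OF i] u(2)[OF i] using m i by blast
      qed
      moreover have "FMor F v \<cdot>\<^bsub>B\<^esub> FMor F w = Id B (FOb F C')"
        using Fc[OF w(1) v(1)] vw F ob by (simp add: is_functor_def)
      ultimately show "m = u \<cdot>\<^bsub>B\<^esub> FMor F w"
        using category.Comp_assoc[OF B FH[OF w(1)] FH[OF v(1)] mH] category.Comp_Id[OF B mH] by simp
    qed
  qed
  then show "is_coproduct I B (\<lambda>i. FOb F (X i)) (FOb F C') (\<lambda>i. FMor F (j' i))"
    by (rule iffD1[OF is_coproduct_cong, rotated 2]) (simp_all add: Y_def)
qed

lemma coproducts_loc: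
  assumes A: "category A" and S: "S \<subseteq> Mor A" and L: "paths_componentwise I A S"
    and closed: "closed_under_coproducts I A S"
  shows "has_coproducts I (loc A S)" and "preserves_coproducts I A (loc A S) (loc_fctr A S)"
proof -
  have ex: "\<exists>C j. is_coproduct I A X C j \<and>
      is_coproduct I (loc A S) X C (\<lambda>i. FMor (loc_fctr A S) (j i))" if X: "X \<in> I \<rightarrow>\<^sub>E Ob A" for X
    using path_coproduct[OF A S L closed X] is_coproduct_loc[OF A S] by metis
  then show "has_coproducts I (loc A S)" unfolding has_coproducts_def loc_simps by blast
  show "preserves_coproducts I A (loc A S) (loc_fctr A S)"
  proof (rule preserves_coproductsI[OF is_functor_loc_fctr[OF A S]])
    fix X assume X: "X \<in> I \<rightarrow>\<^sub>E Ob A"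
    with ex obtain C j where C: "is_coproduct I A X C j"
      "is_coproduct I (loc A S) X C (\<lambda>i. FMor (loc_fctr A S) (j i))" by blast
    then have "C \<in> Ob A" by (simp add: is_coproduct_def)
    with X have "FOb (loc_fctr A S) C = C" "\<And>i. i \<in> I \<Longrightarrow> FOb (loc_fctr A S) (X i) = X i"
      by (auto simp: loc_fctr_def)
    then have "is_coproduct I (loc A S) (\<lambda>i. FOb (loc_fctr A S) (X i)) (FOb (loc_fctr A S) C)
        (\<lambda>i. FMor (loc_fctr A S) (j i))"
      using C(2) is_coproduct_cong[of I "\<lambda>i. FOb (loc_fctr A S) (X i)" X
          "\<lambda>i. FMor (loc_fctr A S) (j i)" "\<lambda>i. FMor (loc_fctr A S) (j i)"] by simp
    with C(1) show "\<exists>C j. is_coproduct I A X C j \<and> is_coproduct I (loc A S)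
        (\<lambda>i. FOb (loc_fctr A S) (X i)) (FOb (loc_fctr A S) C) (\<lambda>i. FMor (loc_fctr A S) (j i))" by blast
  qed
qed

lemma is_functor_opp: "is_functor A B F \<Longrightarrow> is_functor (opp A) (opp B) F"
  unfolding is_functor_def by (auto simp: category_opp)

lemma products_loc:
  assumes A: "category A" and S: "S \<subseteq> Mor A" and L: "paths_componentwise I (opp A) S"
    and closed: "closed_under_products I A S"
  shows "has_products I (loc A S)" and "preserves_products I A (loc A S) (loc_fctr A S)"
proof -
  have S': "S \<subseteq> Mor (opp A)" using S by simp
  have ex: "\<exists>C j. is_product I A X C j \<and>
      is_product I (loc A S) X C (\<lambda>i. FMor (loc_fctr A S) (j i))" if X: "X \<in> I \<rightarrow>\<^sub>E Ob A" for X
  proof -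
    obtain C j where "is_coproduct I (opp A) X C j" "path_coproduct I (opp A) S X C j"
      using path_coproduct[OF category_opp[OF A] S' L closed[unfolded closed_under_products_opp]] X by auto
    then show ?thesis using is_product_loc[OF A S, of I X C j] unfolding is_product_opp by blast
  qed
  then show "has_products I (loc A S)" unfolding has_products_def loc_simps by blast
  have "preserves_coproducts I (opp A) (opp (loc A S)) (loc_fctr A S)"
  proof (rule preserves_coproductsI[OF is_functor_opp[OF is_functor_loc_fctr[OF A S]]])
    fix X assume "X \<in> I \<rightarrow>\<^sub>E Ob (opp A)"
    then have X: "X \<in> I \<rightarrow>\<^sub>E Ob A" by simp
    with ex obtain C j where C: "is_product I A X C j"
      "is_product I (loc A S) X C (\<lambda>i. FMor (loc_fctr A S) (j i))" by blast
    then have "C \<in> Ob A" by (simp add: is_product_def)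
    with X have "FOb (loc_fctr A S) C = C" "\<And>i. i \<in> I \<Longrightarrow> FOb (loc_fctr A S) (X i) = X i"
      by (auto simp: loc_fctr_def)
    then have "is_coproduct I (opp (loc A S)) (\<lambda>i. FOb (loc_fctr A S) (X i)) (FOb (loc_fctr A S) C)
        (\<lambda>i. FMor (loc_fctr A S) (j i))"
      using C(2) is_coproduct_cong[of I "\<lambda>i. FOb (loc_fctr A S) (X i)" X
          "\<lambda>i. FMor (loc_fctr A S) (j i)" "\<lambda>i. FMor (loc_fctr A S) (j i)"] by (simp add: is_product_opp)
    moreover have "is_coproduct I (opp A) X C j" using C(1) by (simp add: is_product_opp)
    ultimately show "\<exists>C j. is_coproduct I (opp A) X C j \<and> is_coproduct I (opp (loc A S))
        (\<lambda>i. FOb (loc_fctr A S) (X i)) (FOb (loc_fctr A S) C) (\<lambda>i. FMor (loc_fctr A S) (j i))"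
      by blast
  qed
  then show "preserves_products I A (loc A S) (loc_fctr A S)"
    unfolding preserves_products_def preserves_coproducts_def is_product_opp .
qed

section \<open>Both kinds of calculus\<close>

text \<open>Either calculus gives the property on one of the two sides, and duality carries it to the other;
  so a calculus on one side serves coproducts and products alike.\<close>

lemma paths_componentwise_calculus:
  assumes A: "category A" and S: "S \<subseteq> Mor A" and LR: "left_calculus A S \<or> right_calculus A S"
  shows "paths_componentwise I A S" and "paths_componentwise I (opp A) S"
proof -
  have A': "category (opp A)" and S': "S \<subseteq> Mor (opp A)" using category_opp[OF A] S by simp_all
  have "paths_componentwise I A S \<or> paths_componentwise I (opp A) S"
    using LR paths_componentwise_right[OF A S] paths_componentwise_right[OF A' S']
    by (auto simp: left_calculus_opp)
  then show "paths_componentwise I A S" and "paths_componentwise I (opp A) S"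
    using paths_componentwise_opp[OF A S, of I] paths_componentwise_opp[OF A' S', of I] by auto
qed

theorem corollary6p2:
  fixes A :: "('o, 'm) cat" and S :: "'m set" and I :: "'i set"
  assumes "category A" and "S \<subseteq> Mor A"
  shows
    "(right_calculus A S \<longrightarrow>
        right_calculus (power_cat I A) (power_mors I S) \<and>
        (\<exists>!\<Theta>. is_canonical_comparison I A S \<Theta>) \<and>
        (\<forall>\<Theta>. is_canonical_comparison I A S \<Theta> \<longrightarrow>
          is_cat_iso (loc (power_cat I A) (power_mors I S)) (power_cat I (loc A S)) \<Theta>)) \<and>
     (left_calculus A S \<longrightarrow>
        left_calculus (power_cat I A) (power_mors I S) \<and>
        (\<exists>!\<Theta>. is_canonical_comparison I A S \<Theta>) \<and>
        (\<forall>\<Theta>. is_canonical_comparison I A S \<Theta> \<longrightarrow>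
          is_cat_iso (loc (power_cat I A) (power_mors I S)) (power_cat I (loc A S)) \<Theta>)) \<and>
     (left_calculus A S \<or> right_calculus A S \<longrightarrow>
        (has_coproducts I A \<and> closed_under_coproducts I A S \<longrightarrow>
          has_coproducts I (loc A S) \<and> preserves_coproducts I A (loc A S) (loc_fctr A S)) \<and>
        (has_products I A \<and> closed_under_products I A S \<longrightarrow>
          has_products I (loc A S) \<and> preserves_products I A (loc A S) (loc_fctr A S)))"
proof (intro conjI impI allI)
  show "right_calculus (power_cat I A) (power_mors I S)" if "right_calculus A S"
    by (rule right_calculus_power[OF assms(1) that])
  show "left_calculus (power_cat I A) (power_mors I S)" if "left_calculus A S"
    using right_calculus_power[OF category_opp[OF assms(1)], of S I] that
    by (simp add: left_calculus_opp power_cat_opp)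
  show "\<exists>!\<Theta>. is_canonical_comparison I A S \<Theta>" by (rule ex1_canonical_comparison[OF assms])
  show "\<exists>!\<Theta>. is_canonical_comparison I A S \<Theta>" by (rule ex1_canonical_comparison[OF assms])
next
  note L = paths_componentwise_calculus[OF assms, of I]
  fix \<Theta> assume \<Theta>: "is_canonical_comparison I A S \<Theta>"
  show "is_cat_iso (loc (power_cat I A) (power_mors I S)) (power_cat I (loc A S)) \<Theta>"
    if "right_calculus A S"
    using canonical_comparison_iso[OF assms L(1) \<Theta>] that by blast
  show "is_cat_iso (loc (power_cat I A) (power_mors I S)) (power_cat I (loc A S)) \<Theta>"
    if "left_calculus A S"
    using canonical_comparison_iso[OF assms L(1) \<Theta>] that by blast
next
  note L = paths_componentwise_calculus[OF assms, of I]
  assume LR: "left_calculus A S \<or> right_calculus A S"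
  show "has_coproducts I (loc A S)" "preserves_coproducts I A (loc A S) (loc_fctr A S)"
    if "has_coproducts I A \<and> closed_under_coproducts I A S"
    using coproducts_loc[OF assms L(1)[OF LR]] that by blast+
  show "has_products I (loc A S)" "preserves_products I A (loc A S) (loc_fctr A S)"
    if "has_products I A \<and> closed_under_products I A S"
    using products_loc[OF assms L(2)[OF LR]] that by blast+
qed

end
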